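(* Suppose that for every $S\in\Omega$ the function $f(\cdot;S):\mathbb{R}^n\to\mathbb{R}$ is proper, closed, convex and Lipschitz continuous with constant $L_{f,S}>0$, i.e. $|f(x;S)-f(y;S)|\le L_{f,S}\|x-y\|$ for all $x,y\in\mathbb{R}^n$, and that there exists $\kappa>0$ such that $\mathrm{dist}_X^2(x)\le\kappa\,\mathbb{E}[\mathrm{dist}_{X_S}^2(x)]$ for all $x\in\mathbb{R}^n$. Let $\{x^k\}_{k\ge0}$ be generated by algorithm SPP with a nonincreasing positive stepsize sequence $\{\mu_k\}_{k\ge 0}$. Let $\hat\mu_{1,k}=\sum_{i=0}^{k-1}\mu_i$, $\hat\mu_{2,k}=\sum_{i=0}^{k-1}\mu_i^2$, $\hat x^k=\frac{1}{\hat\mu_{1,k}}\sum_{i=0}^{k-1}\mu_i x^i$ and $\mathcal{R}_\mu=\mu_0\kappa\left(\|x^0-x^*\|^2+\mathbb{E}[L_{f,S}^2]\hat\mu_{2,k}\right)$. Then for all $k\ge1$: $$-\kappa\,\mathbb{E}[L_{f,S}^2]\left(\frac{\hat\mu_{2,k}}{\hat\mu_{1,k}}+2\mu_0\right)-\sqrt{\mathbb{E}[L_{f,S}^2]\,\frac{\mathcal{R}_\mu}{\hat\mu_{1,k}}}\;\le\;\mathbb{E}[F(\hat x^k)]-F^*\;\le\;\frac{\mathcal{R}_\mu}{2\mu_0\kappa\hat\mu_{1,k}},$$ $$\mathbb{E}[\mathrm{dist}_X^2(\hat x^k)]\;\le\;2\kappa^2\,\mathbb{E}[L_{f,S}^2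]\left(\frac{\hat\mu_{2,k}}{\hat\mu_{1,k}}+2\mu_0\right)^2+\frac{2\mathcal{R}_\mu}{\hat\mu_{1,k}}.$$
   Context: Problem: $F^*=\min_{x\in\mathbb{R}^n}F(x):=\mathbb{E}[f(x;S)]$ subject to $x\in X:=\bigcap_{S\in\Omega}X_S$, where $S$ is a random variable with probability space $(\Omega,\mathbb{P})$, each $f(\cdot;S):\mathbb{R}^n\to\mathbb{R}$ is convex with full domain, and each $X_S\subseteq\mathbb{R}^n$ is nonempty, closed and convex. $x^*$ denotes any optimal solution. $\|\cdot\|$ is the Euclidean norm, $[\cdot]_Y$ the projection onto a closed convex set $Y$, and $\mathrm{dist}_Y(x)=\|x-[x]_Y\|$. Algorithm SPP (stochastic proximal point) with starting point $x^0\in\mathbb{R}^n$ and stepsizes $\mu_k>0$: for $k=0,1,2,\dots$, draw $S_k\in\Omega$ according to $\mathbb{P}$, independently of $S_0,\dots,S_{k-1}$, and set $y^k=z_{\mu_k}(x^k;S_k)$, $x^{k+1}=[y^k]_{X_{S_k}}$, where $z_\mu(x;S)=\arg\min_{z\in\mathbb{R}^n}\left\{f(z;S)+\frac{1}{2\mu}\|z-x\|^2\right\}$. Expectations are over all random choices. *)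

theory Defs
  imports "HOL-Analysis.Analysis" "HOL-Probability.Probability"
begin

text \<open>The projection $[x]_Y$ is the library's \<open>closest_point Y x\<close>.\<close>

definition dist_proj :: "(real ^ 'n) set \<Rightarrow> real ^ 'n \<Rightarrow> real" where
  "dist_proj Y x = norm (x - closest_point Y x)"

definition prox :: "real \<Rightarrow> (real ^ 'n \<Rightarrow> real) \<Rightarrow> real ^ 'n \<Rightarrow> real ^ 'n" where
  "prox \<mu> g x = arg_min (\<lambda>z. g z + 1 / (2 * \<mu>) * (norm (z - x))\<^sup>2) (\<lambda>_. True)"

text \<open>\<open>spp f X \<mu> x0 s k\<close> is the iterate $x^k$ of the stochastic proximal point method when
  the drawn samples are \<open>s 0, s 1, \<dots>\<close>.\<close>

primrec spp ::
  "('s \<Rightarrow> real ^ 'n \<Rightarrow> real) \<Rightarrow> ('s \<Rightarrow> (real ^ 'n) set) \<Rightarrow> (nat \<Rightarrow> real) \<Rightarrow> real ^ 'n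
    \<Rightarrow> (nat \<Rightarrow> 's) \<Rightarrow> nat \<Rightarrow> real ^ 'n" where
  "spp f X \<mu> x0 s 0 = x0"
| "spp f X \<mu> x0 s (Suc k) =
     closest_point (X (s k)) (prox (\<mu> k) (f (s k)) (spp f X \<mu> x0 s k))"

definition feasible :: "'s measure \<Rightarrow> ('s \<Rightarrow> (real ^ 'n) set) \<Rightarrow> (real ^ 'n) set" where
  "feasible M X = (\<Inter>S\<in>space M. X S)"

definition objective :: "'s measure \<Rightarrow> ('s \<Rightarrow> real ^ 'n \<Rightarrow> real) \<Rightarrow> real ^ 'n \<Rightarrow> real" where
  "objective M f x = (LINT S|M. f S x)"

text \<open>This infimum is the minimum as soon as a minimiser over the feasible set exists.\<close>

definition opt_value :: "'s measure \<Rightarrow> ('s \<Rightarrow> real ^ 'n \<Rightarrow> real) \<Rightarrow> ('s \<Rightarrow> (real ^ 'n) set) \<Rightarrow> real" where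
  "opt_value M f X = (INF x\<in>feasible M X. objective M f x)"

definition mu1 :: "(nat \<Rightarrow> real) \<Rightarrow> nat \<Rightarrow> real" where
  "mu1 \<mu> k = (\<Sum>i<k. \<mu> i)"

definition mu2 :: "(nat \<Rightarrow> real) \<Rightarrow> nat \<Rightarrow> real" where
  "mu2 \<mu> k = (\<Sum>i<k. (\<mu> i)\<^sup>2)"

definition wavg :: "(nat \<Rightarrow> real) \<Rightarrow> (nat \<Rightarrow> real ^ 'n) \<Rightarrow> nat \<Rightarrow> real ^ 'n" where
  "wavg \<mu> x k = (1 / mu1 \<mu> k) *\<^sub>R (\<Sum>i<k. \<mu> i *\<^sub>R x i)"

text \<open>The constant $\mathcal{R}_\mu$, with \<open>L2\<close> standing for $E[L_{f,S}^2]$.\<close>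

definition R_mu ::
  "(nat \<Rightarrow> real) \<Rightarrow> real \<Rightarrow> real \<Rightarrow> real ^ 'n \<Rightarrow> real ^ 'n \<Rightarrow> nat \<Rightarrow> real" where
  "R_mu \<mu> \<kappa> L2 x0 xs k = \<mu> 0 * \<kappa> * ((norm (x0 - xs))\<^sup>2 + L2 * mu2 \<mu> k)"

end

theory Submission
  imports Defs
begin

text \<open>The upper bound is the usual one: \<open>E \<parallel>x\<^sup>i - x\<^sup>*\<parallel>\<^sup>2\<close> telescopes through the three-point inequality
  of the prox map, and Jensen's inequality passes to the average. For feasibility, write \<open>D\<close> for
  \<open>dist\<^sub>X\<close> and \<open>d\<^sub>i\<close> for the distance of \<open>x\<^sup>i\<close> to the sampled set; then
  \<open>D(x\<^bsup>i+1\<^esup>)\<^sup>2 \<le> D(x\<^sup>i)\<^sup>2 - d\<^sub>i\<^sup>2 + 2\<mu>\<^sub>i L D(x\<^sup>i) + \<mu>\<^sub>i\<^sup>2 L\<^sup>2\<close>. Taking expectations, summing and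
  using \<open>\<mu>\<^sub>i E D(x\<^sup>i)\<^sup>2 \<le> \<mu>\<^sub>0 \<kappa> E d\<^sub>i\<^sup>2\<close>, the weighted mean \<open>Q\<close> of the \<open>E D(x\<^sup>i)\<^sup>2\<close> satisfies a
  quadratic inequality in \<open>sqrt Q\<close>, which bounds \<open>E D\<^sup>2\<close> at the average; the lower bound on the
  objective follows since \<open>F x \<ge> F\<^sup>* - E[L] D x\<close>.\<close>

subsection \<open>Prox map and projections\<close>

lemma continuous_on_norm_lipschitz:
  fixes g :: "'a :: real_normed_vector \<Rightarrow> real"
  assumes "\<And>x y. \<bar>g x - g y\<bar> \<le> L * norm (x - y)" "0 \<le> L"
  shows "continuous_on A g"
proof -
  have "L-lipschitz_on A g"
    using assms by (intro lipschitz_onI) (auto simp: dist_norm)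
  then show ?thesis by (rule lipschitz_on_continuous_on)
qed

text \<open>\<open>prox\<close> is a Hilbert choice and says nothing until a minimiser is known to
  exist. A continuous function attains its minimum on a compact ball, and outside a large ball the
  quadratic term makes every value at least \<open>h x\<close>.\<close>

lemma prox_minimizer:
  fixes g :: "real ^ 'n \<Rightarrow> real"
  assumes lip: "\<And>x y. \<bar>g x - g y\<bar> \<le> L * norm (x - y)" and L: "L > 0" and mu: "\<mu> > 0"
  shows "g (prox \<mu> g x) + 1 / (2 * \<mu>) * (norm (prox \<mu> g x - x))\<^sup>2
    \<le> g z + 1 / (2 * \<mu>) * (norm (z - x))\<^sup>2"
proof -
  define h where "h z = g z + 1 / (2 * \<mu>) * (norm (z - x))\<^sup>2" for z
  have "continuous_on UNIV g"
    using continuous_on_norm_lipschitz[OF lip] L by simp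
  \<comment> \<open>The radius \<open>2 * \<mu> * L\<close> solves
    \<open>L * r = r\<^sup>2 / (2 * \<mu>)\<close>; beyond it the penalty outweighs any Lipschitz
    decrease of \<open>g\<close>.\<close>
  then have "continuous_on (cball x (2 * \<mu> * L)) h"
    unfolding h_def by (intro continuous_intros) (auto intro: continuous_on_subset)
  moreover have "x \<in> cball x (2 * \<mu> * L)"
    using mu L by simp
  ultimately obtain y where y: "\<And>z. z \<in> cball x (2 * \<mu> * L) \<Longrightarrow> h y \<le> h z"
    using continuous_attains_inf[OF compact_cball] by (metis empty_iff)
  have "h y \<le> h z" for z
  proof (cases "z \<in> cball x (2 * \<mu> * L)")
    case False
    then have far: "norm (z - x) > 2 * \<mu> * L"
      by (simp add: dist_norm norm_minus_commute)
    have "h y \<le> h x"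
      using y[of x] mu L by simp
    also have "h x = g x"
      by (simp add: h_def)
    also have "g x \<le> g z + L * norm (z - x)"
      using lip[of x z] by (simp add: norm_minus_commute)
    also have "L * norm (z - x) \<le> 1 / (2 * \<mu>) * (norm (z - x))\<^sup>2"
    proof -
      have "(2 * \<mu> * L) * norm (z - x) \<le> norm (z - x) * norm (z - x)"
        using far by (intro mult_right_mono) auto
      then show ?thesis
        using mu by (simp add: field_simps power2_eq_square)
    qed
    finally show ?thesis
      by (simp add: h_def)
  qed (rule y)
  then have "is_arg_min h (\<lambda>_. True) y"
    by (auto simp: is_arg_min_def not_less)
  then have "is_arg_min h (\<lambda>_. True) (arg_min h (\<lambda>_. True))"
    unfolding arg_min_def by (rule someI)
  moreover have "prox \<mu> g x = arg_min h (\<lambda>_. True)"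
    by (simp add: prox_def h_def[abs_def])
  ultimately show ?thesis
    by (auto simp: is_arg_min_def not_less h_def)
qed

text \<open>Strong convexity of the squared norm as an exact identity; its last term becomes the
  extra squared distance in the three-point inequality.\<close>

lemma norm_sq_convex_combination:
  fixes x y z :: "'a :: real_inner"
  shows "(norm ((1 - t) *\<^sub>R y + t *\<^sub>R z - x))\<^sup>2
    = (1 - t) * (norm (y - x))\<^sup>2 + t * (norm (z - x))\<^sup>2 - t * (1 - t) * (norm (z - y))\<^sup>2"
proof -
  have *: "(1 - t) *\<^sub>R y + t *\<^sub>R z - x = (1 - t) *\<^sub>R (y - x) + t *\<^sub>R (z - x)"
    by (simp add: algebra_simps)
  have **: "z - y = (z - x) - (y - x)"
    by simp
  show ?thesis
    unfolding * ** power2_norm_eq_inner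
    by (simp add: inner_diff inner_add inner_commute algebra_simps)
qed

text \<open>No subgradients: the minimiser \<open>y\<close> is compared with points of the segment
  from \<open>y\<close> to \<open>z\<close>, the resulting inequality is divided by
  \<open>t\<close>, and \<open>t\<close> tends to 0 from the right.\<close>

lemma prox_three_point:
  fixes g :: "real ^ 'n \<Rightarrow> real" and x z :: "real ^ 'n"
  assumes cvx: "convex_on UNIV g"
    and lip: "\<And>x y. \<bar>g x - g y\<bar> \<le> L * norm (x - y)" and L: "L > 0" and mu: "\<mu> > 0"
  defines "y \<equiv> prox \<mu> g x"
  shows "g y + 1 / (2 * \<mu>) * (norm (y - x))\<^sup>2 + 1 / (2 * \<mu>) * (norm (z - y))\<^sup>2
    \<le> g z + 1 / (2 * \<mu>) * (norm (z - x))\<^sup>2"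
proof -
  define c where "c = 1 / (2 * \<mu>)"
  have c: "c > 0" using mu by (simp add: c_def)
  have *: "g y + c * (norm (y - x))\<^sup>2 + c * (1 - t) * (norm (z - y))\<^sup>2 \<le> g z + c * (norm (z - x))\<^sup>2"
    if t: "0 < t" "t < 1" for t
  proof -
    let ?w = "(1 - t) *\<^sub>R y + t *\<^sub>R z"
    have "g y + c * (norm (y - x))\<^sup>2 \<le> g ?w + c * (norm (?w - x))\<^sup>2"
      unfolding y_def c_def by (rule prox_minimizer[OF lip L mu])
    also have "g ?w \<le> (1 - t) * g y + t * g z"
      using t by (intro convex_onD[OF cvx]) auto
    finally have "t * (g y + c * (norm (y - x))\<^sup>2 + c * (1 - t) * (norm (z - y))\<^sup>2)
        \<le> t * (g z + c * (norm (z - x))\<^sup>2)"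
      unfolding norm_sq_convex_combination by (simp add: algebra_simps)
    then show ?thesis
      using t by (simp add: mult_le_cancel_left_pos)
  qed
  have "((\<lambda>t. g y + c * (norm (y - x))\<^sup>2 + c * (1 - t) * (norm (z - y))\<^sup>2)
      \<longlongrightarrow> g y + c * (norm (y - x))\<^sup>2 + c * (1 - 0) * (norm (z - y))\<^sup>2) (at_right 0)"
    by (intro tendsto_intros)
  moreover have "\<forall>\<^sub>F t in at_right (0::real).
      g y + c * (norm (y - x))\<^sup>2 + c * (1 - t) * (norm (z - y))\<^sup>2 \<le> g z + c * (norm (z - x))\<^sup>2"
    unfolding eventually_at_right_field using * by (intro exI[of _ 1]) auto
  ultimately have "g y + c * (norm (y - x))\<^sup>2 + c * (1 - 0) * (norm (z - y))\<^sup>2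
      \<le> g z + c * (norm (z - x))\<^sup>2"
    by (rule tendsto_upperbound) simp
  then show ?thesis by (simp add: c_def)
qed

text \<open>Testing the three-point inequality at \<open>z = x\<close> counts the squared step
  twice, which gives the constant \<open>\<mu> * L\<close> instead of the
  \<open>2 * \<mu> * L\<close> that minimality alone would yield.\<close>

lemma norm_prox_diff_le:
  fixes g :: "real ^ 'n \<Rightarrow> real"
  assumes cvx: "convex_on UNIV g"
    and lip: "\<And>x y. \<bar>g x - g y\<bar> \<le> L * norm (x - y)" and L: "L > 0" and mu: "\<mu> > 0"
  shows "norm (prox \<mu> g x - x) \<le> \<mu> * L"
proof (cases "prox \<mu> g x = x")
  case False
  let ?p = "norm (prox \<mu> g x - x)"
  have "1 / (2 * \<mu>) * ?p\<^sup>2 + 1 / (2 * \<mu>) * ?p\<^sup>2 \<le> g x - g (prox \<mu> g x)"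
    using prox_three_point[OF cvx lip L mu, of x x] by (simp add: norm_minus_commute)
  also have "\<dots> \<le> L * ?p"
    using lip[of x "prox \<mu> g x"] by (simp add: norm_minus_commute)
  finally have "?p * ?p \<le> (\<mu> * L) * ?p"
    using mu by (simp add: field_simps power2_eq_square)
  then show ?thesis using False by simp
qed (use mu L in simp)

text \<open>Each prox point is tested in the three-point inequality of the other; in the sum the
  values of \<open>g\<close> cancel and firm nonexpansiveness remains. It supplies the continuity in
  \<open>x\<close> behind joint measurability.\<close>

lemma prox_nonexpansive:
  fixes g :: "real ^ 'n \<Rightarrow> real"
  assumes cvx: "convex_on UNIV g"
    and lip: "\<And>x y. \<bar>g x - g y\<bar> \<le> L * norm (x - y)" and L: "L > 0" and mu: "\<mu> > 0"
  shows "norm (prox \<mu> g a - prox \<mu> g b) \<le> norm (a - b)"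
proof -
  let ?p = "prox \<mu> g a" and ?q = "prox \<mu> g b"
  define c where "c = 1 / (2 * \<mu>)"
  have c: "c > 0" using mu by (simp add: c_def)
  have "c * ((norm (?p - a))\<^sup>2 + (norm (?q - ?p))\<^sup>2 + (norm (?q - b))\<^sup>2 + (norm (?p - ?q))\<^sup>2)
      \<le> c * ((norm (?q - a))\<^sup>2 + (norm (?p - b))\<^sup>2)"
    using prox_three_point[OF cvx lip L mu, of a ?q] prox_three_point[OF cvx lip L mu, of b ?p]
    unfolding c_def[symmetric] by (simp add: algebra_simps)
  then have "(norm (?p - a))\<^sup>2 + (norm (?q - ?p))\<^sup>2 + (norm (?q - b))\<^sup>2 + (norm (?p - ?q))\<^sup>2
      \<le> (norm (?q - a))\<^sup>2 + (norm (?p - b))\<^sup>2"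
    using c by (simp add: mult_le_cancel_left_pos)
  then have "(norm (?p - ?q))\<^sup>2 \<le> inner (?p - ?q) (a - b)"
    unfolding power2_norm_eq_inner by (simp add: inner_diff inner_commute)
  also have "\<dots> \<le> norm (?p - ?q) * norm (a - b)"
    by (rule norm_cauchy_schwarz)
  finally have "norm (?p - ?q) * norm (?p - ?q) \<le> norm (a - b) * norm (?p - ?q)"
    by (simp add: power2_eq_square mult.commute)
  then show ?thesis
    by (cases "?p = ?q") auto
qed

section \<open>Distance to a closed convex set, and one step of the method\<close>

lemma dist_proj_nonneg: "0 \<le> dist_proj Y x"
  by (simp add: dist_proj_def)

lemma dist_proj_le:
  assumes "closed Y" "y \<in> Y"
  shows "dist_proj Y x \<le> norm (x - y)"
  using closest_point_le[OF assms, of x] by (simp add: dist_proj_def dist_norm)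

lemma dist_proj_lipschitz:
  assumes "closed Y" "Y \<noteq> {}"
  shows "\<bar>dist_proj Y x - dist_proj Y y\<bar> \<le> norm (x - y)"
proof -
  have *: "dist_proj Y x \<le> dist_proj Y y + norm (x - y)" for x y
  proof -
    have "dist_proj Y x \<le> norm (x - closest_point Y y)"
      by (rule dist_proj_le[OF assms(1) closest_point_in_set[OF assms]])
    also have "\<dots> \<le> norm (x - y) + norm (y - closest_point Y y)"
      by (rule order_trans[OF _ norm_triangle_ineq]) simp
    finally show ?thesis by (simp add: dist_proj_def)
  qed
  show ?thesis using *[of x y] *[of y x] by (simp add: norm_minus_commute)
qed

lemma continuous_on_dist_proj:
  assumes "closed Y" "Y \<noteq> {}"
  shows "continuous_on A (dist_proj Y)"
  using dist_proj_lipschitz[OF assms] by (intro continuous_on_norm_lipschitz[where L = 1]) auto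

text \<open>The angle at the projection is obtuse. The subtracted square is kept because it is the
  source of the decrease in the feasibility recursion.\<close>

lemma closest_point_pythagoras:
  fixes Y :: "(real ^ 'n) set"
  assumes "convex Y" "closed Y" "w \<in> Y"
  shows "(norm (closest_point Y x - w))\<^sup>2 \<le> (norm (x - w))\<^sup>2 - (dist_proj Y x)\<^sup>2"
proof -
  let ?p = "closest_point Y x"
  have "inner (x - ?p) (w - ?p) \<le> 0"
    by (rule closest_point_dot[OF assms])
  then show ?thesis
    unfolding dist_proj_def power2_norm_eq_inner by (simp add: inner_diff inner_commute)
qed

text \<open>The average of the projections lies in \<open>Y\<close> by convexity, so it can stand in
  for the projection of the average; convexity of squaring does the rest.\<close>

lemma dist_proj_weighted_sum_le:
  fixes Y :: "(real ^ 'n) set"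
  assumes Y: "convex Y" "closed Y" "Y \<noteq> {}"
    and I: "finite I" "\<And>i. i \<in> I \<Longrightarrow> 0 \<le> a i" "sum a I = 1"
  shows "(dist_proj Y (\<Sum>i\<in>I. a i *\<^sub>R x i))\<^sup>2 \<le> (\<Sum>i\<in>I. a i * (dist_proj Y (x i))\<^sup>2)"
proof -
  have mem: "(\<Sum>i\<in>I. a i *\<^sub>R closest_point Y (x i)) \<in> Y"
    using Y I by (intro convex_sum closest_point_in_set) auto
  have "dist_proj Y (\<Sum>i\<in>I. a i *\<^sub>R x i)
      \<le> norm ((\<Sum>i\<in>I. a i *\<^sub>R x i) - (\<Sum>i\<in>I. a i *\<^sub>R closest_point Y (x i)))"
    by (rule dist_proj_le[OF Y(2) mem])
  also have "\<dots> = norm (\<Sum>i\<in>I. a i *\<^sub>R (x i - closest_point Y (x i)))"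
    by (simp add: scaleR_diff_right sum_subtractf)
  also have "\<dots> \<le> (\<Sum>i\<in>I. norm (a i *\<^sub>R (x i - closest_point Y (x i))))"
    by (rule norm_sum)
  also have "\<dots> = (\<Sum>i\<in>I. a i * dist_proj Y (x i))"
    using I by (intro sum.cong) (auto simp: dist_proj_def)
  finally have "(dist_proj Y (\<Sum>i\<in>I. a i *\<^sub>R x i))\<^sup>2 \<le> (\<Sum>i\<in>I. a i *\<^sub>R dist_proj Y (x i))\<^sup>2"
    by (intro power_mono) (auto simp: dist_proj_nonneg)
  also have "\<dots> \<le> (\<Sum>i\<in>I. a i * (dist_proj Y (x i))\<^sup>2)"
    using I by (intro convex_on_sum[where C = UNIV and f = "\<lambda>u. u\<^sup>2"] convex_power2) auto
  finally show ?thesis .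
qed

text \<open>The bound involves \<open>g x\<close> and not \<open>g\<close> at the prox point:
  \<open>x\<close> will be independent of the fresh sample, so \<open>g x\<close> averages to the
  objective. The exchange costs \<open>\<mu>\<^sup>2 * L\<^sup>2\<close>.\<close>

lemma spp_step_distance:
  fixes g :: "real ^ 'n \<Rightarrow> real"
  assumes cvx: "convex_on UNIV g"
    and lip: "\<And>x y. \<bar>g x - g y\<bar> \<le> L * norm (x - y)" and L: "L > 0" and mu: "\<mu> > 0"
    and Y: "convex Y" "closed Y" "w \<in> Y"
  shows "(norm (closest_point Y (prox \<mu> g x) - w))\<^sup>2
    \<le> (norm (x - w))\<^sup>2 + \<mu>\<^sup>2 * L\<^sup>2 - 2 * \<mu> * (g x - g w)"
proof -
  let ?y = "prox \<mu> g x"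
  define p where "p = norm (?y - x)"
  have "(norm (closest_point Y ?y - w))\<^sup>2 \<le> (norm (?y - w))\<^sup>2"
    using closest_point_pythagoras[OF Y, of ?y] by (simp add: order_trans)
  also have "(norm (?y - w))\<^sup>2 \<le> (norm (x - w))\<^sup>2 - p\<^sup>2 - 2 * \<mu> * (g ?y - g w)"
  proof -
    have cancel: "2 * \<mu> * (1 / (2 * \<mu>) * a) = a" for a
      using mu by simp
    have "2 * \<mu> * (g ?y + 1 / (2 * \<mu>) * (norm (?y - x))\<^sup>2 + 1 / (2 * \<mu>) * (norm (w - ?y))\<^sup>2)
        \<le> 2 * \<mu> * (g w + 1 / (2 * \<mu>) * (norm (w - x))\<^sup>2)"
      using prox_three_point[OF cvx lip L mu, of x w] mu by (intro mult_left_mono) auto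
    then show ?thesis
      unfolding distrib_left cancel
      by (simp add: p_def norm_minus_commute[of w] right_diff_distrib)
  qed
  also have "\<dots> \<le> (norm (x - w))\<^sup>2 - p\<^sup>2 + 2 * (\<mu> * L) * p - 2 * \<mu> * (g x - g w)"
  proof -
    have "\<mu> * (g x - g ?y) \<le> \<mu> * (L * p)"
      using lip[of x ?y] mu by (intro mult_left_mono) (auto simp: p_def norm_minus_commute)
    then show ?thesis by (simp add: algebra_simps)
  qed
  \<comment> \<open>Completing the square absorbs
    \<open>- p\<^sup>2 + 2 * (\<mu> * L) * p\<close>.\<close>
  also have "\<dots> \<le> (norm (x - w))\<^sup>2 + \<mu>\<^sup>2 * L\<^sup>2 - 2 * \<mu> * (g x - g w)"
  proof -
    have "0 \<le> (p - \<mu> * L)\<^sup>2" by simp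
    then show ?thesis by (simp add: power2_eq_square algebra_simps)
  qed
  finally show ?thesis .
qed

text \<open>The prox step and its projection move the point \<open>closest_point Y x\<close> by at most \<open>\<mu> * L\<close>,
  so the plain projection of \<open>x\<close> already accounts for the decrease; function values are not needed.\<close>

lemma spp_step_feasibility:
  fixes g :: "real ^ 'n \<Rightarrow> real"
  assumes cvx: "convex_on UNIV g"
    and lip: "\<And>x y. \<bar>g x - g y\<bar> \<le> L * norm (x - y)" and L: "L > 0" and mu: "\<mu> > 0"
    and Y: "convex Y" "closed Y" and Z: "closed Z" "Z \<noteq> {}" "Z \<subseteq> Y"
  shows "(dist_proj Z (closest_point Y (prox \<mu> g x)))\<^sup>2
    \<le> (dist_proj Z x)\<^sup>2 - (dist_proj Y x)\<^sup>2 + 2 * \<mu> * L * dist_proj Z x + \<mu>\<^sup>2 * L\<^sup>2"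
proof -
  let ?w = "closest_point Z x" and ?u = "closest_point Y x"
  let ?x = "closest_point Y (prox \<mu> g x)"
  define D where "D = dist_proj Z x"
  define b where "b = norm (?u - ?w)"
  have w: "?w \<in> Z" by (rule closest_point_in_set[OF Z(1,2)])
  have "norm (?x - ?u) \<le> norm (prox \<mu> g x - x)"
    using closest_point_lipschitz[OF Y, of "prox \<mu> g x" x] w Z(3) by (auto simp: dist_norm)
  also have "\<dots> \<le> \<mu> * L"
    by (rule norm_prox_diff_le[OF cvx lip L mu])
  finally have "norm (?x - ?u) \<le> \<mu> * L" .
  moreover have "norm (?x - ?w) \<le> norm (?x - ?u) + b"
    unfolding b_def by (rule order_trans[OF _ norm_triangle_ineq]) simp
  moreover have "dist_proj Z ?x \<le> norm (?x - ?w)"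
    by (rule dist_proj_le[OF Z(1) w])
  ultimately have "dist_proj Z ?x \<le> \<mu> * L + b"
    by simp
  then have "(dist_proj Z ?x)\<^sup>2 \<le> (\<mu> * L + b)\<^sup>2"
    by (intro power_mono dist_proj_nonneg)
  also have "\<dots> = b\<^sup>2 + 2 * (\<mu> * L) * b + \<mu>\<^sup>2 * L\<^sup>2"
    by (simp add: power2_eq_square algebra_simps)
  finally have 1: "(dist_proj Z ?x)\<^sup>2 \<le> b\<^sup>2 + 2 * (\<mu> * L) * b + \<mu>\<^sup>2 * L\<^sup>2" .
  \<comment> \<open>Since \<open>?w\<close> lies in \<open>Z\<close>, hence in \<open>Y\<close>, the
    obtuse angle at \<open>?u\<close> yields the drop by the squared distance to
    \<open>Y\<close>.\<close>
  have 2: "b\<^sup>2 \<le> D\<^sup>2 - (dist_proj Y x)\<^sup>2"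
    using closest_point_pythagoras[OF Y, of ?w x] w Z(3) by (auto simp: b_def D_def dist_proj_def)
  then have "b\<^sup>2 \<le> D\<^sup>2"
    by (rule order_trans) simp
  then have "b \<le> D"
    by (rule power2_le_imp_le) (simp add: D_def dist_proj_nonneg)
  then have "2 * (\<mu> * L) * b \<le> 2 * (\<mu> * L) * D"
    using mu L by (intro mult_left_mono) auto
  with 1 2 show ?thesis by (simp add: D_def)
qed

subsection \<open>Measurability\<close>

text \<open>\<open>u s\<close> lies in a closed set \<open>C\<close> iff points of a countable dense set come arbitrarily close to
  \<open>C\<close> while having arbitrarily small residual \<open>\<phi> s\<close>.\<close>

lemma borel_measurable_zero_of_residual:
  fixes u :: "'a \<Rightarrow> 'b::{second_countable_topology, metric_space}" and \<phi> :: "'a \<Rightarrow> 'b \<Rightarrow> real"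
  assumes meas[measurable]: "\<And>z. (\<lambda>s. \<phi> s z) \<in> borel_measurable M"
    and cont: "\<And>s. s \<in> space M \<Longrightarrow> continuous_on UNIV (\<phi> s)"
    and zero: "\<And>s. s \<in> space M \<Longrightarrow> \<phi> s (u s) = 0"
    and conv: "\<And>s z. s \<in> space M \<Longrightarrow> (\<lambda>n. \<phi> s (z n)) \<longlonglongrightarrow> 0 \<Longrightarrow> z \<longlonglongrightarrow> u s"
  shows "u \<in> borel_measurable M"
  unfolding borel_eq_closed
proof (intro measurable_measure_of)
  fix C :: "'b set" assume "C \<in> Collect closed"
  then have C: "closed C" by simp
  obtain D :: "'b set" where D: "countable D" "\<And>U. open U \<Longrightarrow> U \<noteq> {} \<Longrightarrow> \<exists>d\<in>D. d \<in> U"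
    using countable_dense_exists by blast
  \<comment> \<open>Members of \<open>E n\<close> are only near \<open>C\<close>, since
    \<open>C\<close> itself may contain no point of the dense set.\<close>
  define E where "E n = {d \<in> D. \<exists>c\<in>C. dist d c < inverse (real (Suc n))}" for n
  have "u -` C \<inter> space M = {s \<in> space M. \<forall>n. \<exists>d\<in>E n. \<bar>\<phi> s d\<bar> < inverse (real (Suc n))}"
  proof (intro set_eqI iffI; clarsimp)
    fix s n assume s: "s \<in> space M" "u s \<in> C"
    let ?U = "ball (u s) (inverse (real (Suc n))) \<inter> {z. \<bar>\<phi> s z\<bar> < inverse (real (Suc n))}"
    have "open {z. \<bar>\<phi> s z\<bar> < inverse (real (Suc n))}"
      using cont[OF s(1)] by (intro open_Collect_less continuous_intros) auto
    then have "open ?U" by auto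
    moreover have "u s \<in> ?U" using zero[OF s(1)] by simp
    ultimately obtain d where "d \<in> D" "d \<in> ?U" using D(2)[of ?U] by blast
    then show "\<exists>d\<in>E n. \<bar>\<phi> s d\<bar> < inverse (1 + real n)"
      using s(2) by (intro bexI[of _ d]) (auto simp: E_def dist_commute)
  next
    \<comment> \<open>The points \<open>d n\<close> converge to \<open>u s\<close> because their
      residuals vanish, the nearby points \<open>c n\<close> of \<open>C\<close> follow them, and
      \<open>C\<close> is closed.\<close>
    fix s assume s: "s \<in> space M" and ex: "\<forall>n. \<exists>d\<in>E n. \<bar>\<phi> s d\<bar> < inverse (1 + real n)"
    then obtain d where d: "\<And>n. d n \<in> E n" "\<And>n. \<bar>\<phi> s (d n)\<bar> < inverse (1 + real n)"
      by metis
    then obtain c where c: "\<And>n. c n \<in> C" "\<And>n. dist (d n) (c n) < inverse (1 + real n)"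
      unfolding E_def by simp metis
    have inv: "(\<lambda>n. inverse (1 + real n)) \<longlonglongrightarrow> 0"
      using LIMSEQ_inverse_real_of_nat by simp
    have "(\<lambda>n. \<phi> s (d n)) \<longlonglongrightarrow> 0"
      by (rule Lim_null_comparison[OF _ inv]) (auto intro!: always_eventually less_imp_le d(2))
    then have "(\<lambda>n. dist (d n) (u s)) \<longlonglongrightarrow> 0"
      using conv[OF s] tendsto_dist_iff by blast
    moreover have "(\<lambda>n. dist (d n) (c n)) \<longlonglongrightarrow> 0"
      by (rule Lim_null_comparison[OF _ inv]) (auto intro!: always_eventually less_imp_le c(2))
    ultimately have sum: "(\<lambda>n. dist (d n) (c n) + dist (d n) (u s)) \<longlonglongrightarrow> 0"
      using tendsto_add by force
    have "(\<lambda>n. dist (c n) (u s)) \<longlonglongrightarrow> 0"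
      by (rule Lim_null_comparison[OF _ sum]) (auto intro!: always_eventually dist_triangle3)
    then have "c \<longlonglongrightarrow> u s"
      by (rule tendsto_dist_iff[THEN iffD2])
    then show "u s \<in> C"
      using C c(1) closed_sequentially by blast
  qed
  also have "\<dots> \<in> sets M"
  proof -
    have [simp]: "countable (E n)" for n
      using D(1) by (auto simp: E_def)
    show ?thesis by measurable
  qed
  finally show "u -` C \<inter> space M \<in> sets M" .
qed auto

text \<open>The second argument is approximated pointwise by simple functions \<open>F i\<close>.
  With finitely many values to insert, measurability in \<open>s\<close> suffices; continuity in
  \<open>x\<close> carries it to the limit.\<close>

lemma borel_measurable_Caratheodory:
  fixes g :: "'a \<Rightarrow> 'b::{second_countable_topology, metric_space} \<Rightarrow> 'c::metric_space"
  assumes meas[measurable]: "\<And>x. (\<lambda>s. g s x) \<in> borel_measurable M"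
    and cont: "\<And>s. s \<in> space M \<Longrightarrow> continuous_on UNIV (g s)"
  shows "(\<lambda>(s, x). g s x) \<in> borel_measurable (M \<Otimes>\<^sub>M borel)"
proof -
  obtain F :: "nat \<Rightarrow> 'b \<Rightarrow> 'b" where F: "\<And>i. simple_function borel (F i)" "\<And>x. (\<lambda>i. F i x) \<longlonglongrightarrow> x"
    using borel_measurable_implies_sequence_metric[of "\<lambda>x::'b. x" borel undefined] by auto
  show ?thesis
  proof (rule borel_measurable_LIMSEQ_metric)
    fix i
    have [measurable]: "F i \<in> measurable borel (count_space (range (F i)))"
      using F(1)[of i] by (auto simp: simple_function_def intro!: measurable_count_space_eq2[THEN iffD2])
    have "(\<lambda>p. (\<lambda>x p. g (fst p) x) (F i (snd p)) p) \<in> borel_measurable (M \<Otimes>\<^sub>M borel)"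
    proof (rule measurable_compose_countable'[where I = "range (F i)"])
      show "countable (range (F i))"
        using F(1)[of i] by (simp add: simple_function_def countable_finite)
    qed measurable
    then show "(\<lambda>(s, x). g s (F i x)) \<in> borel_measurable (M \<Otimes>\<^sub>M borel)"
      by (simp add: case_prod_beta')
  next
    fix p assume "p \<in> space (M \<Otimes>\<^sub>M (borel :: 'b measure))"
    then obtain s x where p: "p = (s, x)" "s \<in> space M"
      by (auto simp: space_pair_measure)
    have "(\<lambda>i. g s (F i x)) \<longlonglongrightarrow> g s x"
      using cont[OF p(2)] F(2)[of x]
      by (auto simp: continuous_on_eq_continuous_at intro: isCont_tendsto_compose)
    then show "(\<lambda>i. case p of (s, x) \<Rightarrow> g s (F i x)) \<longlonglongrightarrow> (case p of (s, x) \<Rightarrow> g s x)"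
      by (simp add: p)
  qed
qed

text \<open>For fixed \<open>x\<close> the residual adds the distance of \<open>z\<close> from
  \<open>X s\<close> to the excess of \<open>norm (z - x)\<close> over the optimal distance. It is
  built from measurable distance functions and vanishes exactly at the projection.\<close>

lemma borel_measurable_closest_point:
  fixes X :: "'a \<Rightarrow> (real ^ 'n) set"
  assumes X: "\<And>s. s \<in> space M \<Longrightarrow> X s \<noteq> {} \<and> closed (X s) \<and> convex (X s)"
    and meas[measurable]: "\<And>x. (\<lambda>s. dist_proj (X s) x) \<in> borel_measurable M"
  shows "(\<lambda>(s, x). closest_point (X s) x) \<in> borel_measurable (M \<Otimes>\<^sub>M borel)"
proof (rule borel_measurable_Caratheodory)
  fix x :: "real ^ 'n"
  let ?\<phi> = "\<lambda>s z. dist_proj (X s) z + max 0 (norm (z - x) - dist_proj (X s) x)"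
  show "(\<lambda>s. closest_point (X s) x) \<in> borel_measurable M"
  proof (rule borel_measurable_zero_of_residual[where \<phi> = ?\<phi>])
    fix s assume s: "s \<in> space M"
    note Xs = X[OF s]
    show "continuous_on UNIV (?\<phi> s)"
      using Xs by (intro continuous_intros continuous_on_dist_proj) auto
    show "?\<phi> s (closest_point (X s) x) = 0"
      using Xs closest_point_self[OF closest_point_in_set, of "X s" x]
      by (simp add: dist_proj_def norm_minus_commute)
    fix z :: "nat \<Rightarrow> real ^ 'n"
    assume lim: "(\<lambda>n. ?\<phi> s (z n)) \<longlonglongrightarrow> 0"
    have bound: "norm (z n - closest_point (X s) x)
        \<le> ?\<phi> s (z n) + sqrt (2 * dist_proj (X s) x * ?\<phi> s (z n) + (?\<phi> s (z n))\<^sup>2)" for n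
    proof -
      define e where "e = ?\<phi> s (z n)"
      define d where "d = dist_proj (X s) x"
      \<comment> \<open>\<open>?q\<close> is feasible, within \<open>e\<close> of \<open>z n\<close>
        and at most \<open>d + e\<close> from \<open>x\<close>; the obtuse-angle inequality then
        puts it within \<open>sqrt (2 * d * e + e\<^sup>2)\<close> of the projection of
        \<open>x\<close>.\<close>
      let ?q = "closest_point (X s) (z n)"
      have q: "?q \<in> X s" using Xs by (intro closest_point_in_set) auto
      have zq: "norm (z n - ?q) \<le> e" by (simp add: e_def dist_proj_def)
      have "norm (x - ?q) \<le> norm (z n - x) + norm (z n - ?q)"
        using norm_triangle_ineq4[of "z n - ?q" "z n - x"] by simp
      also have "\<dots> \<le> d + e"
        by (simp add: e_def d_def dist_proj_def)
      finally have "(norm (x - ?q))\<^sup>2 \<le> (d + e)\<^sup>2"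
        by (intro power_mono) auto
      then have "(norm (closest_point (X s) x - ?q))\<^sup>2 \<le> 2 * d * e + e\<^sup>2"
        using closest_point_pythagoras[of "X s" ?q x] Xs q
        by (simp add: d_def[symmetric] power2_sum algebra_simps)
      then have "norm (closest_point (X s) x - ?q) \<le> sqrt (2 * d * e + e\<^sup>2)"
        by (rule real_le_rsqrt)
      moreover have "norm (z n - closest_point (X s) x)
          \<le> norm (z n - ?q) + norm (closest_point (X s) x - ?q)"
        using norm_triangle_ineq4[of "z n - ?q" "closest_point (X s) x - ?q"] by simp
      ultimately have "norm (z n - closest_point (X s) x) \<le> e + sqrt (2 * d * e + e\<^sup>2)"
        using zq by linarith
      then show ?thesis
        by (simp only: e_def d_def)
    qed
    have "(\<lambda>n. ?\<phi> s (z n) + sqrt (2 * dist_proj (X s) x * ?\<phi> s (z n) + (?\<phi> s (z n))\<^sup>2))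
        \<longlonglongrightarrow> 0 + sqrt (2 * dist_proj (X s) x * 0 + 0\<^sup>2)"
      by (intro tendsto_add[OF lim] tendsto_real_sqrt tendsto_add tendsto_mult[OF tendsto_const lim]
          tendsto_power[OF lim])
    then have "(\<lambda>n. z n - closest_point (X s) x) \<longlonglongrightarrow> 0"
      by (intro Lim_null_comparison[OF always_eventually[OF allI[OF bound]]]) simp
    then show "z \<longlonglongrightarrow> closest_point (X s) x"
      by (rule Lim_null[THEN iffD2])
  qed measurable
next
  fix s assume "s \<in> space M"
  then show "continuous_on UNIV (closest_point (X s))"
    using X by (intro continuous_on_closest_point) auto
qed

text \<open>The residual is the optimality gap of the prox objective. By the three-point inequality,
  a small gap forces closeness to the prox point.\<close>

lemma borel_measurable_prox:
  fixes f :: "'a \<Rightarrow> real ^ 'n \<Rightarrow> real"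
  assumes meas[measurable]: "\<And>x. (\<lambda>s. f s x) \<in> borel_measurable M"
    and cvx: "\<And>s. s \<in> space M \<Longrightarrow> convex_on UNIV (f s)"
    and L: "\<And>s. s \<in> space M \<Longrightarrow> L s > 0"
    and lip: "\<And>s x y. s \<in> space M \<Longrightarrow> \<bar>f s x - f s y\<bar> \<le> L s * norm (x - y)"
    and mu: "\<mu> > 0"
  shows "(\<lambda>(s, x). prox \<mu> (f s) x) \<in> borel_measurable (M \<Otimes>\<^sub>M borel)"
proof (rule borel_measurable_Caratheodory)
  have contf: "continuous_on UNIV (f s)" if "s \<in> space M" for s
    using L[OF that] by (intro continuous_on_norm_lipschitz[OF lip[OF that]]) simp
  fix x :: "real ^ 'n"
  obtain D :: "(real ^ 'n) set"
    where D: "countable D" "\<And>U. open U \<Longrightarrow> U \<noteq> {} \<Longrightarrow> \<exists>d\<in>D. d \<in> U"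
    using countable_dense_exists by blast
  define h where "h s z = f s z + 1 / (2 * \<mu>) * (norm (z - x))\<^sup>2" for s z
  let ?m = "\<lambda>s. INF d\<in>D. h s d"
  have [measurable]: "(\<lambda>s. h s z) \<in> borel_measurable M" for z
    unfolding h_def by measurable
  have conth: "continuous_on UNIV (h s)" if "s \<in> space M" for s
    unfolding h_def using contf[OF that] by (intro continuous_intros)
  have min: "h s (prox \<mu> (f s) x) \<le> h s z" if "s \<in> space M" for s z
    unfolding h_def by (rule prox_minimizer[OF lip[OF that] L[OF that] mu])
  have bdd: "bdd_below (h s ` D)" if "s \<in> space M" for s
    using min[OF that] by (intro bdd_belowI2)
  have ne: "D \<noteq> {}" using D(2)[of UNIV] by auto
  \<comment> \<open>By continuity the minimum equals the infimum over the countable dense set, which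
    makes it measurable in \<open>s\<close>.\<close>
  have m_eq: "?m s = h s (prox \<mu> (f s) x)" if s: "s \<in> space M" for s
  proof (rule antisym)
    show "h s (prox \<mu> (f s) x) \<le> ?m s"
      by (intro cINF_greatest ne min[OF s])
    show "?m s \<le> h s (prox \<mu> (f s) x)"
    proof (rule field_le_epsilon)
      fix e :: real assume "e > 0"
      have "open {z. h s z < h s (prox \<mu> (f s) x) + e}"
        by (intro open_Collect_less conth[OF s] continuous_intros)
      moreover have "prox \<mu> (f s) x \<in> {z. h s z < h s (prox \<mu> (f s) x) + e}"
        using \<open>e > 0\<close> by simp
      ultimately obtain d where "d \<in> D" "h s d < h s (prox \<mu> (f s) x) + e"
        using D(2)[of "{z. h s z < h s (prox \<mu> (f s) x) + e}"] by blast
      then show "?m s \<le> h s (prox \<mu> (f s) x) + e"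
        using cINF_lower[OF bdd[OF s], of d] by linarith
    qed
  qed
  have [measurable]: "?m \<in> borel_measurable M"
    using D(1) bdd by (intro borel_measurable_cINF) auto
  let ?\<phi> = "\<lambda>s z. h s z - ?m s"
  show "(\<lambda>s. prox \<mu> (f s) x) \<in> borel_measurable M"
  proof (rule borel_measurable_zero_of_residual[where \<phi> = ?\<phi>])
    fix s assume s: "s \<in> space M"
    show "continuous_on UNIV (?\<phi> s)"
      by (intro continuous_intros conth[OF s])
    show "?\<phi> s (prox \<mu> (f s) x) = 0"
      by (simp add: m_eq[OF s])
    fix z :: "nat \<Rightarrow> real ^ 'n"
    assume lim: "(\<lambda>n. ?\<phi> s (z n)) \<longlonglongrightarrow> 0"
    have bound: "norm (z n - prox \<mu> (f s) x) \<le> sqrt (2 * \<mu> * ?\<phi> s (z n))" for n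
    proof (rule real_le_rsqrt)
      have "1 / (2 * \<mu>) * (norm (z n - prox \<mu> (f s) x))\<^sup>2 \<le> ?\<phi> s (z n)"
        using prox_three_point[OF cvx[OF s] lip[OF s] L[OF s] mu, of x "z n"]
        unfolding m_eq[OF s] by (simp add: h_def)
      then show "(norm (z n - prox \<mu> (f s) x))\<^sup>2 \<le> 2 * \<mu> * ?\<phi> s (z n)"
        using mu by (simp add: field_simps)
    qed
    have "(\<lambda>n. sqrt (2 * \<mu> * ?\<phi> s (z n))) \<longlonglongrightarrow> sqrt (2 * \<mu> * 0)"
      by (intro tendsto_real_sqrt tendsto_mult[OF tendsto_const lim])
    then have "(\<lambda>n. z n - prox \<mu> (f s) x) \<longlonglongrightarrow> 0"
      by (intro Lim_null_comparison[OF always_eventually[OF allI[OF bound]]]) simp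
    then show "z \<longlonglongrightarrow> prox \<mu> (f s) x"
      by (rule Lim_null[THEN iffD2])
  qed measurable
next
  fix s assume s: "s \<in> space M"
  have "1-lipschitz_on UNIV (prox \<mu> (f s))"
    using prox_nonexpansive[OF cvx[OF s] lip[OF s] L[OF s] mu]
    by (intro lipschitz_onI) (auto simp: dist_norm)
  then show "continuous_on UNIV (prox \<mu> (f s))"
    by (rule lipschitz_on_continuous_on)
qed

subsection \<open>The stochastic process\<close>

text \<open>Iterate \<open>i\<close> is determined by the samples before time \<open>i\<close>; this
  is what makes it independent of sample \<open>i\<close>.\<close>

lemma spp_cong:
  assumes "\<And>j. j < i \<Longrightarrow> w j = w' j"
  shows "spp f X \<mu> x0 w i = spp f X \<mu> x0 w' i"
  using assms by (induction i) auto

text \<open>Otherwise \<open>q\<close> and \<open>q - 2 * \<alpha>\<close> both exceed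
  \<open>sqrt \<beta>\<close>, and so their product exceeds \<open>\<beta>\<close>. The bound
  relaxes the exact root \<open>\<alpha> + sqrt (\<alpha>\<^sup>2 + \<beta>)\<close> to a form that
  separates \<open>\<alpha>\<close> from \<open>\<beta>\<close>.\<close>

lemma le_of_square_le_affine:
  fixes q \<alpha> \<beta> :: real
  assumes "q\<^sup>2 \<le> \<beta> + 2 * \<alpha> * q" "0 \<le> \<alpha>" "0 \<le> \<beta>"
  shows "q \<le> 2 * \<alpha> + sqrt \<beta>"
proof (rule ccontr)
  assume "\<not> ?thesis"
  then have "sqrt \<beta> < q" "sqrt \<beta> < q - 2 * \<alpha>"
    using assms(2) by linarith+
  then have "sqrt \<beta> * sqrt \<beta> < q * (q - 2 * \<alpha>)"
    by (intro mult_strict_mono') (auto simp: assms(3))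
  then show False
    using assms by (simp add: power2_eq_square algebra_simps)
qed

lemma (in prob_space) square_expectation_le:
  fixes Y :: "'a \<Rightarrow> real"
  assumes "Y \<in> borel_measurable M" "integrable M (\<lambda>\<omega>. (Y \<omega>)\<^sup>2)"
  shows "(expectation Y)\<^sup>2 \<le> expectation (\<lambda>\<omega>. (Y \<omega>)\<^sup>2)"
  using variance_positive[of Y] variance_eq[OF square_integrable_imp_integrable[OF assms] assms(2)]
  by simp

text \<open>The samples are random elements on a second space \<open>N\<close> with common law
  \<open>M\<close>. Measurability of the random set \<open>X\<close> is encoded through its distance
  functions, from which joint measurability of the projection follows.\<close>

locale spp_process = M: prob_space M + N: prob_space N
  for M :: "'s measure" and N :: "'w measure" +
  fixes f :: "'s \<Rightarrow> real ^ 'n \<Rightarrow> real"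
    and X :: "'s \<Rightarrow> (real ^ 'n) set"
    and L :: "'s \<Rightarrow> real"
    and \<kappa> :: real
    and \<mu> :: "nat \<Rightarrow> real"
    and x0 xstar :: "real ^ 'n"
    and S :: "nat \<Rightarrow> 'w \<Rightarrow> 's"
  assumes f_integrable: "\<And>x. integrable M (\<lambda>s. f s x)"
    and f_convex: "\<And>s. s \<in> space M \<Longrightarrow> convex_on UNIV (f s)"
    and L_pos: "\<And>s. s \<in> space M \<Longrightarrow> L s > 0"
    and f_lipschitz: "\<And>s x y. s \<in> space M \<Longrightarrow> \<bar>f s x - f s y\<bar> \<le> L s * norm (x - y)"
    and L2_integrable: "integrable M (\<lambda>s. (L s)\<^sup>2)"
    and X_set: "\<And>s. s \<in> space M \<Longrightarrow> X s \<noteq> {} \<and> closed (X s) \<and> convex (X s)"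
    and X_measurable: "\<And>x. (\<lambda>s. dist_proj (X s) x) \<in> borel_measurable M"
    and xstar_optimal: "is_arg_min (objective M f) (\<lambda>x. x \<in> feasible M X) xstar"
    and kappa_pos: "\<kappa> > 0"
    and regularity: "\<And>x. (dist_proj (feasible M X) x)\<^sup>2 \<le> \<kappa> * (LINT s|M. (dist_proj (X s) x)\<^sup>2)"
    and mu_pos: "\<And>i. \<mu> i > 0"
    and mu_decseq: "decseq \<mu>"
    and S_indep: "N.indep_vars (\<lambda>_. M) S UNIV"
    and S_distr: "\<And>i. distr N M (S i) = M"
begin

abbreviation "F \<equiv> objective M f"
abbreviation "C \<equiv> feasible M X"
abbreviation "D \<equiv> dist_proj C"
definition "L1 = (LINT s|M. L s)"
definition "L2 = (LINT s|M. (L s)\<^sup>2)"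
definition "iter i \<omega> = spp f X \<mu> x0 (\<lambda>j. S j \<omega>) i"

lemma iter_0: "iter 0 \<omega> = x0"
  by (simp add: iter_def)

lemma iter_Suc: "iter (Suc i) \<omega> = closest_point (X (S i \<omega>)) (prox (\<mu> i) (f (S i \<omega>)) (iter i \<omega>))"
  by (simp add: iter_def)

section \<open>The objective, the feasible set and the Lipschitz moments\<close>

lemma measurable_f[measurable]: "(\<lambda>s. f s x) \<in> borel_measurable M"
  using f_integrable by auto

lemma measurable_L[measurable]: "L \<in> borel_measurable M"
proof -
  have "(\<lambda>s. sqrt ((L s)\<^sup>2)) \<in> borel_measurable M"
    using L2_integrable by measurable
  then show ?thesis
    using L_pos by (subst measurable_cong[where g = "\<lambda>s. sqrt ((L s)\<^sup>2)"]) (auto simp: less_imp_le)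
qed

lemma L_integrable: "integrable M L"
  by (rule M.square_integrable_imp_integrable[OF measurable_L L2_integrable])

lemma L1_nonneg: "0 \<le> L1"
  unfolding L1_def using L_pos by (intro integral_nonneg_AE AE_I2) (auto intro: less_imp_le)

lemma L2_nonneg: "0 \<le> L2"
  unfolding L2_def by (intro integral_nonneg_AE AE_I2) auto

lemma L1_le: "L1 \<le> sqrt L2"
  using M.square_expectation_le[OF measurable_L L2_integrable]
  by (intro real_le_rsqrt) (simp add: L1_def L2_def)

lemma F_lipschitz: "\<bar>F x - F y\<bar> \<le> L1 * norm (x - y)"
proof -
  have "F x - F y = (LINT s|M. f s x - f s y)"
    by (simp add: objective_def f_integrable)
  also have "\<bar>\<dots>\<bar> \<le> (LINT s|M. \<bar>f s x - f s y\<bar>)"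
    by (rule integral_abs_bound)
  also have "\<dots> \<le> (LINT s|M. L s * norm (x - y))"
    using f_lipschitz by (intro integral_mono) (auto simp: f_integrable L_integrable)
  finally show ?thesis
    by (simp add: L1_def)
qed

lemma measurable_F[measurable]: "F \<in> borel_measurable borel"
  by (intro borel_measurable_continuous_onI continuous_on_norm_lipschitz[OF F_lipschitz L1_nonneg])

lemma F_convex: "convex_on UNIV F"
proof (rule convex_onI)
  fix t :: real and x y :: "real ^ 'n" assume t: "0 < t" "t < 1"
  have "F ((1 - t) *\<^sub>R x + t *\<^sub>R y) \<le> (LINT s|M. (1 - t) * f s x + t * f s y)"
    unfolding objective_def using t
    by (intro integral_mono convex_onD[OF f_convex]) (auto simp: f_integrable)
  then show "F ((1 - t) *\<^sub>R x + t *\<^sub>R y) \<le> (1 - t) * F x + t * F y"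
    by (simp add: objective_def f_integrable)
qed simp

lemma xstar_feasible: "xstar \<in> C"
  using xstar_optimal by (simp add: is_arg_min_def)

lemma xstar_in: "s \<in> space M \<Longrightarrow> xstar \<in> X s"
  using xstar_feasible by (auto simp: feasible_def)

lemma F_xstar_le: "z \<in> C \<Longrightarrow> F xstar \<le> F z"
  using xstar_optimal by (auto simp: is_arg_min_def not_less)

lemma opt_value_eq: "opt_value M f X = F xstar"
  unfolding opt_value_def
  by (intro cInf_eq_minimum) (auto intro: xstar_feasible F_xstar_le)

lemma C_set: "convex C" "closed C" "C \<noteq> {}"
  unfolding feasible_def using X_set xstar_feasible
  by (auto intro!: convex_INT closed_INT simp: feasible_def)

lemma C_subset: "s \<in> space M \<Longrightarrow> C \<subseteq> X s"
  by (auto simp: feasible_def)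

lemma D_le: "D x \<le> norm (x - xstar)"
  by (rule dist_proj_le[OF C_set(2) xstar_feasible])

lemma measurable_D[measurable]: "D \<in> borel_measurable borel"
  using C_set by (intro borel_measurable_continuous_onI continuous_on_dist_proj)

text \<open>An infeasible point may have a value below the optimum; optimality is applied at its
  projection, and Lipschitz continuity pays for the move.\<close>

lemma F_lower: "F xstar - L1 * D x \<le> F x"
proof -
  let ?w = "closest_point C x"
  have "F xstar \<le> F ?w"
    by (intro F_xstar_le closest_point_in_set C_set)
  moreover have "\<bar>F x - F ?w\<bar> \<le> L1 * D x"
    using F_lipschitz[of x ?w] by (simp add: dist_proj_def)
  ultimately show ?thesis by linarith
qed

section \<open>The joint law of the current iterate and the fresh sample\<close>

lemma measurable_S[measurable]: "S i \<in> measurable N M"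
  using S_indep by (auto simp: N.indep_vars_def2)

lemma S_space: "\<omega> \<in> space N \<Longrightarrow> S i \<omega> \<in> space M"
  by (rule measurable_space[OF measurable_S])

text \<open>A general index set \<open>J\<close> lets the induction raise \<open>i\<close> within
  one fixed product space.\<close>

lemma measurable_spp:
  assumes "{..<i} \<subseteq> J"
  shows "(\<lambda>w. spp f X \<mu> x0 w i) \<in> borel_measurable (PiM J (\<lambda>_. M))"
  using assms
proof (induction i)
  case (Suc i)
  note [measurable] = borel_measurable_prox[OF measurable_f f_convex L_pos f_lipschitz mu_pos, of i]
    borel_measurable_closest_point[OF X_set X_measurable]
  have [measurable]: "(\<lambda>w. spp f X \<mu> x0 w i) \<in> borel_measurable (PiM J (\<lambda>_. M))"
    using Suc by (auto simp: lessThan_Suc)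
  have [measurable]: "(\<lambda>w. w i) \<in> measurable (PiM J (\<lambda>_. M)) M"
    using Suc.prems by (intro measurable_component_singleton) auto
  have "(\<lambda>w. (\<lambda>(s, x). closest_point (X s) x)
      (w i, (\<lambda>(s, x). prox (\<mu> i) (f s) x) (w i, spp f X \<mu> x0 w i))) \<in> borel_measurable (PiM J (\<lambda>_. M))"
    by measurable
  then show ?case by simp
qed simp

lemma iter_restrict: "iter i \<omega> = spp f X \<mu> x0 (restrict (\<lambda>j. S j \<omega>) {..<i}) i"
  unfolding iter_def by (rule spp_cong) simp

lemma measurable_iter[measurable]: "iter i \<in> borel_measurable N"
proof -
  have "(\<lambda>\<omega>. spp f X \<mu> x0 (restrict (\<lambda>j. S j \<omega>) {..<i}) i) \<in> borel_measurable N"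
    by (rule measurable_compose[OF _ measurable_spp[of i "{..<i}"]]) (auto intro: measurable_restrict)
  then show ?thesis
    by (simp add: iter_restrict[symmetric])
qed

text \<open>\<open>iter i\<close> is a function of the samples in the block \<open>{..<i}\<close>
  and \<open>S i\<close> of the disjoint block \<open>{i}\<close>. Independence of the blocks makes
  the joint law a product, with second factor \<open>M\<close>.\<close>

lemma distr_iter_S:
  "distr N borel (iter i) \<Otimes>\<^sub>M M = distr N (borel \<Otimes>\<^sub>M M) (\<lambda>\<omega>. (iter i \<omega>, S i \<omega>))"
proof -
  let ?PA = "PiM {..<i} (\<lambda>_. M)" and ?PB = "PiM {i} (\<lambda>_. M)"
  let ?rA = "\<lambda>\<omega>. restrict (\<lambda>j. S j \<omega>) {..<i}" and ?rB = "\<lambda>\<omega>. restrict (\<lambda>j. S j \<omega>) {i}"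
  let ?x = "\<lambda>w. spp f X \<mu> x0 w i" and ?s = "\<lambda>w. w i"
  have [measurable]: "?rA \<in> measurable N ?PA" "?rB \<in> measurable N ?PB"
    by (auto intro!: measurable_restrict)
  have [measurable]: "?x \<in> borel_measurable ?PA" "?s \<in> measurable ?PB M"
    by (auto intro: measurable_spp measurable_component_singleton)
  have indep: "distr N ?PA ?rA \<Otimes>\<^sub>M distr N ?PB ?rB = distr N (?PA \<Otimes>\<^sub>M ?PB) (\<lambda>\<omega>. (?rA \<omega>, ?rB \<omega>))"
    using N.indep_var_restrict[OF S_indep, of "{..<i}" "{i}"] unfolding N.indep_var_distribution_eq
    by auto
  have A: "distr (distr N ?PA ?rA) borel ?x = distr N borel (iter i)"
    by (subst distr_distr) (auto simp: comp_def iter_restrict[symmetric])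
  have B: "distr (distr N ?PB ?rB) M ?s = M"
    by (subst distr_distr) (auto simp: comp_def S_distr)
  have "distr N borel (iter i) \<Otimes>\<^sub>M M
      = distr (distr N ?PA ?rA) borel ?x \<Otimes>\<^sub>M distr (distr N ?PB ?rB) M ?s"
    unfolding A B ..
  also have "\<dots> = distr (distr N ?PA ?rA \<Otimes>\<^sub>M distr N ?PB ?rB) (borel \<Otimes>\<^sub>M M) (\<lambda>(v, w). (?x v, ?s w))"
    by (rule pair_measure_distr) (auto simp: B intro: M.sigma_finite_measure_axioms)
  also have "\<dots> = distr N (borel \<Otimes>\<^sub>M M) (\<lambda>\<omega>. (iter i \<omega>, S i \<omega>))"
    unfolding indep by (subst distr_distr) (auto simp: comp_def iter_restrict[symmetric])
  finally show ?thesis .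
qed

text \<open>Fubini on the product law takes the place of conditioning on the past: the fresh sample
  is integrated out with the iterate held fixed.\<close>

lemma expectation_iter:
  fixes g :: "real ^ 'n \<Rightarrow> 's \<Rightarrow> real"
  assumes [measurable]: "case_prod g \<in> borel_measurable (borel \<Otimes>\<^sub>M M)"
    and int: "integrable N (\<lambda>\<omega>. g (iter i \<omega>) (S i \<omega>))"
  shows "(LINT \<omega>|N. g (iter i \<omega>) (S i \<omega>)) = (LINT \<omega>|N. LINT s|M. g (iter i \<omega>) s)"
    and "integrable N (\<lambda>\<omega>. LINT s|M. g (iter i \<omega>) s)"
proof -
  let ?P = "distr N borel (iter i)"
  interpret P: prob_space ?P
    by (rule N.prob_space_distr) measurable
  interpret PM: pair_sigma_finite ?P M ..
  note eq = distr_iter_S[of i]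
  have int': "integrable (?P \<Otimes>\<^sub>M M) (case_prod g)"
    unfolding eq using int by (subst integrable_distr_eq) auto
  have "(LINT \<omega>|N. g (iter i \<omega>) (S i \<omega>)) = (LINT p|(?P \<Otimes>\<^sub>M M). case_prod g p)"
    unfolding eq by (subst integral_distr) auto
  also have "\<dots> = (LINT x|?P. LINT s|M. g x s)"
    using PM.integral_fst'[OF int'] by simp
  also have "\<dots> = (LINT \<omega>|N. LINT s|M. g (iter i \<omega>) s)"
    by (subst integral_distr) auto
  finally show "(LINT \<omega>|N. g (iter i \<omega>) (S i \<omega>)) = (LINT \<omega>|N. LINT s|M. g (iter i \<omega>) s)" .
  have "integrable ?P (\<lambda>x. LINT s|M. g x s)"
    using PM.integrable_fst'[OF int'] by simp
  then show "integrable N (\<lambda>\<omega>. LINT s|M. g (iter i \<omega>) s)"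
    by (rule integrable_distr[rotated]) measurable
qed

lemma L2_S: "integrable N (\<lambda>\<omega>. (L (S i \<omega>))\<^sup>2)" "(LINT \<omega>|N. (L (S i \<omega>))\<^sup>2) = L2"
proof -
  have "integrable (distr N M (S i)) (\<lambda>s. (L s)\<^sup>2)"
    unfolding S_distr by (rule L2_integrable)
  then show "integrable N (\<lambda>\<omega>. (L (S i \<omega>))\<^sup>2)"
    by (rule integrable_distr[OF measurable_S])
  have "L2 = (LINT s|distr N M (S i). (L s)\<^sup>2)"
    unfolding S_distr by (simp add: L2_def)
  also have "\<dots> = (LINT \<omega>|N. (L (S i \<omega>))\<^sup>2)"
    by (rule integral_distr) measurable
  finally show "(LINT \<omega>|N. (L (S i \<omega>))\<^sup>2) = L2" ..
qed

section \<open>Pathwise recursions and square integrability of the iterates\<close>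

lemma iter_Suc_distance:
  assumes "\<omega> \<in> space N"
  shows "(norm (iter (Suc i) \<omega> - xstar))\<^sup>2 \<le> (norm (iter i \<omega> - xstar))\<^sup>2
    + (\<mu> i)\<^sup>2 * (L (S i \<omega>))\<^sup>2 - 2 * \<mu> i * (f (S i \<omega>) (iter i \<omega>) - f (S i \<omega>) xstar)"
  unfolding iter_Suc using S_space[OF assms] X_set xstar_in
  by (intro spp_step_distance f_convex f_lipschitz L_pos mu_pos) auto

lemma iter_Suc_feasibility:
  assumes "\<omega> \<in> space N"
  shows "(D (iter (Suc i) \<omega>))\<^sup>2 \<le> (D (iter i \<omega>))\<^sup>2 - (dist_proj (X (S i \<omega>)) (iter i \<omega>))\<^sup>2
    + 2 * \<mu> i * L (S i \<omega>) * D (iter i \<omega>) + (\<mu> i)\<^sup>2 * (L (S i \<omega>))\<^sup>2"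
  unfolding iter_Suc using S_space[OF assms] X_set C_set C_subset
  by (intro spp_step_feasibility f_convex f_lipschitz L_pos mu_pos) auto

lemma iter_square_integrable: "integrable N (\<lambda>\<omega>. (norm (iter i \<omega> - xstar))\<^sup>2)"
proof (induction i)
  case (Suc i)
  have "integrable N (\<lambda>\<omega>. 2 * (norm (iter i \<omega> - xstar))\<^sup>2 + 2 * ((\<mu> i)\<^sup>2 * (L (S i \<omega>))\<^sup>2))"
    using Suc L2_S(1)[of i] by (intro Bochner_Integration.integrable_add integrable_mult_right)
  then show ?case
  proof (rule Bochner_Integration.integrable_bound)
    show "AE \<omega> in N. norm ((norm (iter (Suc i) \<omega> - xstar))\<^sup>2)
        \<le> norm (2 * (norm (iter i \<omega> - xstar))\<^sup>2 + 2 * ((\<mu> i)\<^sup>2 * (L (S i \<omega>))\<^sup>2))"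
    proof (rule AE_I2)
      fix \<omega> assume w: "\<omega> \<in> space N"
      define r where "r = norm (iter i \<omega> - xstar)"
      define l where "l = \<mu> i * L (S i \<omega>)"
      have "\<bar>f (S i \<omega>) (iter i \<omega>) - f (S i \<omega>) xstar\<bar> \<le> L (S i \<omega>) * r"
        unfolding r_def by (rule f_lipschitz[OF S_space[OF w]])
      then have "\<mu> i * (- (f (S i \<omega>) (iter i \<omega>) - f (S i \<omega>) xstar)) \<le> \<mu> i * (L (S i \<omega>) * r)"
        using mu_pos[of i] by (intro mult_left_mono) auto
      then have "(norm (iter (Suc i) \<omega> - xstar))\<^sup>2 \<le> r\<^sup>2 + l\<^sup>2 + 2 * l * r"
        using iter_Suc_distance[OF w, of i]
        by (simp add: r_def l_def power_mult_distrib algebra_simps)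
      \<comment> \<open>The left side is \<open>(r + l)\<^sup>2\<close>, so the mixed term is
        absorbed into the two squares, already known to be integrable.\<close>
      also have "\<dots> \<le> 2 * r\<^sup>2 + 2 * l\<^sup>2"
        using sum_squares_bound[of l r] by simp
      finally show "norm ((norm (iter (Suc i) \<omega> - xstar))\<^sup>2)
          \<le> norm (2 * (norm (iter i \<omega> - xstar))\<^sup>2 + 2 * ((\<mu> i)\<^sup>2 * (L (S i \<omega>))\<^sup>2))"
        by (simp add: r_def l_def power_mult_distrib)
    qed
  qed measurable
qed (simp add: iter_0)

lemma iter_integrable: "integrable N (\<lambda>\<omega>. norm (iter i \<omega> - xstar))"
  by (rule N.square_integrable_imp_integrable[OF _ iter_square_integrable]) measurable

lemma D_iter_integrable:
  "integrable N (\<lambda>\<omega>. D (iter i \<omega>))" "integrable N (\<lambda>\<omega>. (D (iter i \<omega>))\<^sup>2)"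
proof -
  show "integrable N (\<lambda>\<omega>. D (iter i \<omega>))"
    by (rule Bochner_Integration.integrable_bound[OF iter_integrable[of i]])
      (auto simp: D_le dist_proj_nonneg)
  show "integrable N (\<lambda>\<omega>. (D (iter i \<omega>))\<^sup>2)"
    by (rule Bochner_Integration.integrable_bound[OF iter_square_integrable[of i]])
      (auto intro!: power_mono simp: D_le dist_proj_nonneg)
qed

lemma F_integrable:
  assumes [measurable]: "u \<in> borel_measurable N"
    and "integrable N (\<lambda>\<omega>. norm (u \<omega> - xstar))"
  shows "integrable N (\<lambda>\<omega>. F (u \<omega>))"
proof -
  have "integrable N (\<lambda>\<omega>. F (u \<omega>) - F xstar)"
  proof (rule Bochner_Integration.integrable_bound)
    show "integrable N (\<lambda>\<omega>. L1 * norm (u \<omega> - xstar))"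
      using assms(2) by simp
    show "AE \<omega> in N. norm (F (u \<omega>) - F xstar) \<le> norm (L1 * norm (u \<omega> - xstar))"
      using F_lipschitz L1_nonneg by (auto simp: abs_mult)
  qed measurable
  then show ?thesis
    using Bochner_Integration.integrable_add[of N "\<lambda>\<omega>. F (u \<omega>) - F xstar" "\<lambda>_. F xstar"] by simp
qed

lemma product_integrable:
  "integrable N (\<lambda>\<omega>. L (S i \<omega>) * norm (iter i \<omega> - xstar))"
proof (rule Bochner_Integration.integrable_bound)
  show "integrable N (\<lambda>\<omega>. (L (S i \<omega>))\<^sup>2 + (norm (iter i \<omega> - xstar))\<^sup>2)"
    using L2_S(1) iter_square_integrable by simp
  show "AE \<omega> in N. norm (L (S i \<omega>) * norm (iter i \<omega> - xstar))
      \<le> norm ((L (S i \<omega>))\<^sup>2 + (norm (iter i \<omega> - xstar))\<^sup>2)"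
  proof (rule AE_I2)
    fix \<omega> assume w: "\<omega> \<in> space N"
    have "0 \<le> L (S i \<omega>) * norm (iter i \<omega> - xstar)"
      using L_pos[OF S_space[OF w]] by (intro mult_nonneg_nonneg) (auto intro: less_imp_le)
    then show "norm (L (S i \<omega>) * norm (iter i \<omega> - xstar))
        \<le> norm ((L (S i \<omega>))\<^sup>2 + (norm (iter i \<omega> - xstar))\<^sup>2)"
      using sum_squares_bound[of "L (S i \<omega>)" "norm (iter i \<omega> - xstar)"] by simp
  qed
qed measurable

section \<open>Expectations with the fresh sample integrated out\<close>

lemma measurable_f_pair[measurable]: "(\<lambda>(s, x). f s x) \<in> borel_measurable (M \<Otimes>\<^sub>M borel)"
proof (rule borel_measurable_Caratheodory[OF measurable_f])
  fix s assume s: "s \<in> space M"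
  show "continuous_on UNIV (f s)"
    using L_pos[OF s] by (intro continuous_on_norm_lipschitz[OF f_lipschitz[OF s]]) simp
qed

lemma measurable_dist_proj_pair[measurable]:
  "(\<lambda>(s, x). dist_proj (X s) x) \<in> borel_measurable (M \<Otimes>\<^sub>M borel)"
  using X_set by (intro borel_measurable_Caratheodory X_measurable continuous_on_dist_proj) auto

text \<open>The measurability results put the sample first, the joint law puts the iterate
  first.\<close>

lemma measurable_swap_pair:
  assumes [measurable]: "(\<lambda>(s, x). h s x) \<in> borel_measurable (M \<Otimes>\<^sub>M borel)"
  shows "(\<lambda>(x, s). h s x) \<in> borel_measurable (borel \<Otimes>\<^sub>M M)"
proof -
  have "(\<lambda>p. (\<lambda>(s, x). h s x) (snd p, fst p)) \<in> borel_measurable (borel \<Otimes>\<^sub>M M)"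
    by measurable
  then show ?thesis by (simp add: case_prod_beta')
qed

text \<open>Taking the difference with the value at \<open>xstar\<close> allows domination by the
  integrable product of \<open>L\<close> and the distance to \<open>xstar\<close>.\<close>

lemma expectation_iter_f:
  "integrable N (\<lambda>\<omega>. f (S i \<omega>) (iter i \<omega>) - f (S i \<omega>) xstar)"
  "(LINT \<omega>|N. f (S i \<omega>) (iter i \<omega>) - f (S i \<omega>) xstar) = (LINT \<omega>|N. F (iter i \<omega>)) - F xstar"
proof -
  note [measurable] = measurable_swap_pair[OF measurable_f_pair]
  have meas: "(\<lambda>(x, s). f s x - f s xstar) \<in> borel_measurable (borel \<Otimes>\<^sub>M M)"
  proof -
    have "(\<lambda>p. (\<lambda>(x, s). f s x) p - f (snd p) xstar) \<in> borel_measurable (borel \<Otimes>\<^sub>M M)"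
      by measurable
    then show ?thesis by (simp add: case_prod_beta')
  qed
  have [measurable]: "(\<lambda>\<omega>. f (S i \<omega>) (iter i \<omega>) - f (S i \<omega>) xstar) \<in> borel_measurable N"
    using measurable_compose[OF measurable_Pair[OF measurable_iter[of i] measurable_S[of i]] meas] by simp
  show int: "integrable N (\<lambda>\<omega>. f (S i \<omega>) (iter i \<omega>) - f (S i \<omega>) xstar)"
  proof (rule Bochner_Integration.integrable_bound[OF product_integrable[of i]])
    show "AE \<omega> in N. norm (f (S i \<omega>) (iter i \<omega>) - f (S i \<omega>) xstar)
        \<le> norm (L (S i \<omega>) * norm (iter i \<omega> - xstar))"
      using f_lipschitz[OF S_space] by (auto intro!: AE_I2 order_trans[OF _ abs_ge_self])
  qed measurable
  have "integrable N (\<lambda>\<omega>. F (iter i \<omega>))"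
    by (rule F_integrable[OF measurable_iter iter_integrable])
  then show "(LINT \<omega>|N. f (S i \<omega>) (iter i \<omega>) - f (S i \<omega>) xstar) = (LINT \<omega>|N. F (iter i \<omega>)) - F xstar"
    using expectation_iter(1)[OF meas int] by (simp add: f_integrable objective_def[symmetric] N.prob_space)
qed

lemma expectation_iter_L_D:
  "integrable N (\<lambda>\<omega>. L (S i \<omega>) * D (iter i \<omega>))"
  "(LINT \<omega>|N. L (S i \<omega>) * D (iter i \<omega>)) = L1 * (LINT \<omega>|N. D (iter i \<omega>))"
proof -
  have meas: "(\<lambda>(x, s). L s * D x) \<in> borel_measurable (borel \<Otimes>\<^sub>M M)"
    by measurable
  show int: "integrable N (\<lambda>\<omega>. L (S i \<omega>) * D (iter i \<omega>))"
  proof (rule Bochner_Integration.integrable_bound[OF product_integrable[of i]])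
    show "AE \<omega> in N. norm (L (S i \<omega>) * D (iter i \<omega>)) \<le> norm (L (S i \<omega>) * norm (iter i \<omega> - xstar))"
      by (auto intro!: AE_I2 mult_left_mono simp: abs_mult D_le dist_proj_nonneg)
  qed measurable
  show "(LINT \<omega>|N. L (S i \<omega>) * D (iter i \<omega>)) = L1 * (LINT \<omega>|N. D (iter i \<omega>))"
    using expectation_iter(1)[OF meas int] by (simp add: L1_def)
qed

text \<open>The regularity inequality is applied at the iterate for each fixed
  \<open>\<omega>\<close>; Fubini then turns the inner mean over \<open>M\<close> into the distance
  to the sampled set.\<close>

lemma expectation_iter_dist:
  "integrable N (\<lambda>\<omega>. (dist_proj (X (S i \<omega>)) (iter i \<omega>))\<^sup>2)"
  "(LINT \<omega>|N. (D (iter i \<omega>))\<^sup>2) \<le> \<kappa> * (LINT \<omega>|N. (dist_proj (X (S i \<omega>)) (iter i \<omega>))\<^sup>2)"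
proof -
  note [measurable] = measurable_swap_pair[OF measurable_dist_proj_pair]
  have meas: "(\<lambda>(x, s). (dist_proj (X s) x)\<^sup>2) \<in> borel_measurable (borel \<Otimes>\<^sub>M M)"
  proof -
    have "(\<lambda>p. ((\<lambda>(x, s). dist_proj (X s) x) p)\<^sup>2) \<in> borel_measurable (borel \<Otimes>\<^sub>M M)"
      by measurable
    then show ?thesis by (simp add: case_prod_beta')
  qed
  have [measurable]: "(\<lambda>\<omega>. (dist_proj (X (S i \<omega>)) (iter i \<omega>))\<^sup>2) \<in> borel_measurable N"
    using measurable_compose[OF measurable_Pair[OF measurable_iter[of i] measurable_S[of i]] meas] by simp
  show int: "integrable N (\<lambda>\<omega>. (dist_proj (X (S i \<omega>)) (iter i \<omega>))\<^sup>2)"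
  proof (rule Bochner_Integration.integrable_bound[OF iter_square_integrable[of i]])
    show "AE \<omega> in N. norm ((dist_proj (X (S i \<omega>)) (iter i \<omega>))\<^sup>2) \<le> norm ((norm (iter i \<omega> - xstar))\<^sup>2)"
      using X_set[OF S_space] xstar_in[OF S_space]
      by (auto intro!: AE_I2 power_mono dist_proj_le dist_proj_nonneg)
  qed measurable
  have "(LINT \<omega>|N. (D (iter i \<omega>))\<^sup>2) \<le> (LINT \<omega>|N. \<kappa> * (LINT s|M. (dist_proj (X s) (iter i \<omega>))\<^sup>2))"
    using expectation_iter(2)[OF meas int]
    by (intro integral_mono D_iter_integrable integrable_mult_right regularity)
  then show "(LINT \<omega>|N. (D (iter i \<omega>))\<^sup>2) \<le> \<kappa> * (LINT \<omega>|N. (dist_proj (X (S i \<omega>)) (iter i \<omega>))\<^sup>2)"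
    using expectation_iter(1)[OF meas int] by simp
qed

section \<open>Recursions in expectation and their telescoped sums\<close>

lemma expected_distance_step:
  "(LINT \<omega>|N. (norm (iter (Suc i) \<omega> - xstar))\<^sup>2) \<le> (LINT \<omega>|N. (norm (iter i \<omega> - xstar))\<^sup>2)
    + (\<mu> i)\<^sup>2 * L2 - 2 * \<mu> i * ((LINT \<omega>|N. F (iter i \<omega>)) - F xstar)"
proof -
  have "(LINT \<omega>|N. (norm (iter (Suc i) \<omega> - xstar))\<^sup>2) \<le> (LINT \<omega>|N. (norm (iter i \<omega> - xstar))\<^sup>2
    + (\<mu> i)\<^sup>2 * (L (S i \<omega>))\<^sup>2 - 2 * \<mu> i * (f (S i \<omega>) (iter i \<omega>) - f (S i \<omega>) xstar))"
    by (intro integral_mono iter_Suc_distance iter_square_integrable Bochner_Integration.integrable_diff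
        Bochner_Integration.integrable_add integrable_mult_right L2_S(1) expectation_iter_f(1))
  also have "\<dots> = (LINT \<omega>|N. (norm (iter i \<omega> - xstar))\<^sup>2)
    + (\<mu> i)\<^sup>2 * L2 - 2 * \<mu> i * ((LINT \<omega>|N. F (iter i \<omega>)) - F xstar)"
    by (simp add: iter_square_integrable L2_S expectation_iter_f)
  finally show ?thesis .
qed

lemma expected_feasibility_step:
  "(LINT \<omega>|N. (D (iter (Suc i) \<omega>))\<^sup>2) \<le> (LINT \<omega>|N. (D (iter i \<omega>))\<^sup>2)
    - (LINT \<omega>|N. (dist_proj (X (S i \<omega>)) (iter i \<omega>))\<^sup>2)
    + 2 * \<mu> i * (L1 * (LINT \<omega>|N. D (iter i \<omega>))) + (\<mu> i)\<^sup>2 * L2"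
proof -
  have "(LINT \<omega>|N. (D (iter (Suc i) \<omega>))\<^sup>2) \<le> (LINT \<omega>|N. (D (iter i \<omega>))\<^sup>2
    - (dist_proj (X (S i \<omega>)) (iter i \<omega>))\<^sup>2
    + 2 * \<mu> i * (L (S i \<omega>) * D (iter i \<omega>)) + (\<mu> i)\<^sup>2 * (L (S i \<omega>))\<^sup>2)"
    using iter_Suc_feasibility
    by (intro integral_mono D_iter_integrable(2) Bochner_Integration.integrable_diff
        Bochner_Integration.integrable_add integrable_mult_right L2_S(1) expectation_iter_L_D(1)
        expectation_iter_dist(1)) (simp add: mult.assoc)
  also have "\<dots> = (LINT \<omega>|N. (D (iter i \<omega>))\<^sup>2)
    - (LINT \<omega>|N. (dist_proj (X (S i \<omega>)) (iter i \<omega>))\<^sup>2)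
    + 2 * \<mu> i * (L1 * (LINT \<omega>|N. D (iter i \<omega>))) + (\<mu> i)\<^sup>2 * L2"
    by (simp add: D_iter_integrable L2_S expectation_iter_L_D expectation_iter_dist(1))
  finally show ?thesis .
qed

lemma expected_distance_sum:
  "2 * (\<Sum>i<k. \<mu> i * ((LINT \<omega>|N. F (iter i \<omega>)) - F xstar)) \<le> (norm (x0 - xstar))\<^sup>2 + L2 * mu2 \<mu> k"
proof -
  let ?r = "\<lambda>i. LINT \<omega>|N. (norm (iter i \<omega> - xstar))\<^sup>2"
  \<comment> \<open>The last squared distance stays on the left to close the induction and is
    dropped afterwards as nonnegative.\<close>
  have "?r k + 2 * (\<Sum>i<k. \<mu> i * ((LINT \<omega>|N. F (iter i \<omega>)) - F xstar))
      \<le> (norm (x0 - xstar))\<^sup>2 + L2 * mu2 \<mu> k"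
  proof (induction k)
    case (Suc k)
    then show ?case
      using expected_distance_step[of k] by (simp add: mu2_def algebra_simps)
  qed (simp add: iter_0 N.prob_space mu2_def)
  moreover have "0 \<le> ?r k"
    by (intro integral_nonneg_AE AE_I2) auto
  ultimately show ?thesis by linarith
qed

lemma expected_feasibility_sum:
  "(\<Sum>i<k. LINT \<omega>|N. (dist_proj (X (S i \<omega>)) (iter i \<omega>))\<^sup>2)
    \<le> (norm (x0 - xstar))\<^sup>2 + L2 * mu2 \<mu> k + 2 * L1 * (\<Sum>i<k. \<mu> i * (LINT \<omega>|N. D (iter i \<omega>)))"
proof -
  let ?r = "\<lambda>i. LINT \<omega>|N. (D (iter i \<omega>))\<^sup>2"
  have "?r k + (\<Sum>i<k. LINT \<omega>|N. (dist_proj (X (S i \<omega>)) (iter i \<omega>))\<^sup>2)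
      \<le> (D x0)\<^sup>2 + L2 * mu2 \<mu> k + 2 * L1 * (\<Sum>i<k. \<mu> i * (LINT \<omega>|N. D (iter i \<omega>)))"
  proof (induction k)
    case (Suc k)
    then show ?case
      using expected_feasibility_step[of k] by (simp add: mu2_def algebra_simps)
  qed (simp add: iter_0 N.prob_space mu2_def)
  \<comment> \<open>The initial distance to the feasible set is relaxed to the one to
    \<open>xstar\<close>, so that the bound matches \<open>R_mu\<close>.\<close>
  moreover have "(D x0)\<^sup>2 \<le> (norm (x0 - xstar))\<^sup>2"
    by (intro power_mono D_le dist_proj_nonneg)
  moreover have "0 \<le> ?r k"
    by (intro integral_nonneg_AE AE_I2) auto
  ultimately show ?thesis by linarith
qed

section \<open>Bounds at the weighted average\<close>

context
  fixes k :: nat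
  assumes k_pos: "k \<ge> 1"
begin

definition "xhat \<omega> = wavg \<mu> (\<lambda>i. iter i \<omega>) k"
definition "a i = \<mu> i / mu1 \<mu> k"
definition "Q = (\<Sum>i<k. a i * (LINT \<omega>|N. (D (iter i \<omega>))\<^sup>2))"

lemma mu1_pos: "0 < mu1 \<mu> k"
  unfolding mu1_def using k_pos mu_pos by (intro sum_pos) (auto simp: lessThan_empty_iff)

lemma mu2_nonneg: "0 \<le> mu2 \<mu> k"
  by (simp add: mu2_def sum_nonneg)

lemma a_nonneg: "0 \<le> a i"
  using mu_pos[of i] mu1_pos by (simp add: a_def)

lemma a_sum: "(\<Sum>i<k. a i) = 1"
  using mu1_pos unfolding a_def sum_divide_distrib[symmetric] by (simp add: mu1_def)

lemma xhat_eq_sum: "xhat \<omega> = (\<Sum>i<k. a i *\<^sub>R iter i \<omega>)"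
  by (simp add: xhat_def wavg_def a_def scaleR_sum_right)

lemma measurable_xhat[measurable]: "xhat \<in> borel_measurable N"
  unfolding xhat_eq_sum[abs_def] by measurable

lemma xhat_distance: "norm (xhat \<omega> - xstar) \<le> (\<Sum>i<k. a i * norm (iter i \<omega> - xstar))"
proof -
  have "xhat \<omega> - xstar = (\<Sum>i<k. a i *\<^sub>R (iter i \<omega> - xstar))"
    by (simp add: xhat_eq_sum scaleR_diff_right sum_subtractf scaleR_left.sum[symmetric] a_sum)
  also have "norm \<dots> \<le> (\<Sum>i<k. norm (a i *\<^sub>R (iter i \<omega> - xstar)))"
    by (rule norm_sum)
  finally show ?thesis by (simp add: a_nonneg)
qed

lemma F_xhat_integrable: "integrable N (\<lambda>\<omega>. F (xhat \<omega>))"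
proof (rule F_integrable)
  have "integrable N (\<lambda>\<omega>. \<Sum>i<k. a i * norm (iter i \<omega> - xstar))"
    by (intro Bochner_Integration.integrable_sum integrable_mult_right iter_integrable)
  then show "integrable N (\<lambda>\<omega>. norm (xhat \<omega> - xstar))"
    by (rule Bochner_Integration.integrable_bound)
      (auto intro!: AE_I2 order_trans[OF xhat_distance] order_trans[OF _ abs_ge_self])
qed measurable

lemma D_xhat: "(D (xhat \<omega>))\<^sup>2 \<le> (\<Sum>i<k. a i * (D (iter i \<omega>))\<^sup>2)"
  unfolding xhat_eq_sum by (intro dist_proj_weighted_sum_le C_set a_nonneg a_sum) auto

lemma D_xhat_integrable: "integrable N (\<lambda>\<omega>. (D (xhat \<omega>))\<^sup>2)"
proof -
  have "integrable N (\<lambda>\<omega>. \<Sum>i<k. a i * (D (iter i \<omega>))\<^sup>2)"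
    by (intro Bochner_Integration.integrable_sum integrable_mult_right D_iter_integrable)
  then show ?thesis
    by (rule Bochner_Integration.integrable_bound)
      (auto intro!: AE_I2 order_trans[OF D_xhat] order_trans[OF _ abs_ge_self])
qed

lemma expected_D_xhat: "(LINT \<omega>|N. (D (xhat \<omega>))\<^sup>2) \<le> Q"
proof -
  have "(LINT \<omega>|N. (D (xhat \<omega>))\<^sup>2) \<le> (LINT \<omega>|N. (\<Sum>i<k. a i * (D (iter i \<omega>))\<^sup>2))"
    by (intro integral_mono D_xhat_integrable D_xhat Bochner_Integration.integrable_sum
        integrable_mult_right D_iter_integrable)
  also have "\<dots> = Q"
    unfolding Q_def by (subst Bochner_Integration.integral_sum)
      (auto intro!: integrable_mult_right D_iter_integrable)
  finally show ?thesis .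
qed

lemma objective_gap_upper:
  "(LINT \<omega>|N. F (xhat \<omega>)) - F xstar \<le> R_mu \<mu> \<kappa> L2 x0 xstar k / (2 * \<mu> 0 * \<kappa> * mu1 \<mu> k)"
proof -
  have int: "integrable N (\<lambda>\<omega>. F (iter i \<omega>))" for i
    by (rule F_integrable[OF measurable_iter iter_integrable])
  have "(LINT \<omega>|N. F (xhat \<omega>)) \<le> (LINT \<omega>|N. (\<Sum>i<k. a i * F (iter i \<omega>)))"
  proof (intro integral_mono F_xhat_integrable Bochner_Integration.integrable_sum
        integrable_mult_right int)
    show "F (xhat \<omega>) \<le> (\<Sum>i<k. a i * F (iter i \<omega>))" for \<omega>
      unfolding xhat_eq_sum using k_pos
      by (intro convex_on_sum[OF _ _ F_convex] a_sum a_nonneg) (auto simp: lessThan_empty_iff)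
  qed
  also have "\<dots> = (\<Sum>i<k. a i * (LINT \<omega>|N. F (iter i \<omega>)))"
    by (subst Bochner_Integration.integral_sum) (auto intro!: integrable_mult_right int)
  finally have "(LINT \<omega>|N. F (xhat \<omega>)) - F xstar
      \<le> (\<Sum>i<k. a i * (LINT \<omega>|N. F (iter i \<omega>))) - (\<Sum>i<k. a i) * F xstar"
    by (simp add: a_sum)
  also have "\<dots> = (\<Sum>i<k. \<mu> i * ((LINT \<omega>|N. F (iter i \<omega>)) - F xstar)) / mu1 \<mu> k"
    unfolding sum_distrib_right sum_subtractf[symmetric] sum_divide_distrib
    by (intro sum.cong) (auto simp: a_def diff_divide_distrib right_diff_distrib)
  also have "\<dots> \<le> ((norm (x0 - xstar))\<^sup>2 + L2 * mu2 \<mu> k) / 2 / mu1 \<mu> k"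
    using expected_distance_sum[of k] mu1_pos by (intro divide_right_mono) auto
  also have "\<dots> = R_mu \<mu> \<kappa> L2 x0 xstar k / (2 * \<mu> 0 * \<kappa> * mu1 \<mu> k)"
    using kappa_pos mu_pos[of 0] by (simp add: R_mu_def)
  finally show ?thesis .
qed

lemma Q_nonneg: "0 \<le> Q"
  unfolding Q_def
  by (intro sum_nonneg mult_nonneg_nonneg a_nonneg integral_nonneg_AE AE_I2) auto

text \<open>Jensen twice: once for the weights \<open>a i\<close>, once for the expectation.\<close>

lemma weighted_D_le: "(\<Sum>i<k. a i * (LINT \<omega>|N. D (iter i \<omega>))) \<le> sqrt Q"
proof (rule real_le_rsqrt)
  have "(\<Sum>i<k. a i *\<^sub>R (LINT \<omega>|N. D (iter i \<omega>)))\<^sup>2 \<le> (\<Sum>i<k. a i * (LINT \<omega>|N. D (iter i \<omega>))\<^sup>2)"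
    using k_pos
    by (intro convex_on_sum[where C = UNIV and f = "\<lambda>u. u\<^sup>2"] convex_power2 a_sum a_nonneg) (auto simp: lessThan_empty_iff)
  also have "\<dots> \<le> Q"
    unfolding Q_def
    by (intro sum_mono mult_left_mono a_nonneg N.square_expectation_le D_iter_integrable) measurable
  finally show "(\<Sum>i<k. a i * (LINT \<omega>|N. D (iter i \<omega>)))\<^sup>2 \<le> Q" by simp
qed

lemma Q_quadratic:
  "Q \<le> R_mu \<mu> \<kappa> L2 x0 xstar k / mu1 \<mu> k + 2 * (\<kappa> * \<mu> 0 * sqrt L2) * sqrt Q"
proof -
  let ?d = "\<lambda>i. LINT \<omega>|N. (dist_proj (X (S i \<omega>)) (iter i \<omega>))\<^sup>2"
  let ?w = "\<Sum>i<k. \<mu> i * (LINT \<omega>|N. D (iter i \<omega>))"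
  have Q: "Q = (\<Sum>i<k. \<mu> i * (LINT \<omega>|N. (D (iter i \<omega>))\<^sup>2)) / mu1 \<mu> k"
    by (simp add: Q_def a_def sum_divide_distrib)
  have w: "?w / mu1 \<mu> k \<le> sqrt Q"
    using weighted_D_le by (simp add: sum_divide_distrib a_def)
  \<comment> \<open>Monotone stepsizes replace \<open>\<mu> i\<close> by \<open>\<mu> 0\<close> on
    the right, leaving the unweighted sum of \<open>?d i\<close> that the feasibility recursion
    controls.\<close>
  have "\<mu> i * (LINT \<omega>|N. (D (iter i \<omega>))\<^sup>2) \<le> \<mu> 0 * \<kappa> * ?d i" for i
  proof -
    have "\<mu> i * (LINT \<omega>|N. (D (iter i \<omega>))\<^sup>2) \<le> \<mu> 0 * (\<kappa> * ?d i)"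
      using mu_pos mu_decseq
      by (intro mult_mono expectation_iter_dist(2) integral_nonneg_AE AE_I2)
        (auto simp: decseq_def less_imp_le)
    then show ?thesis by simp
  qed
  then have "(\<Sum>i<k. \<mu> i * (LINT \<omega>|N. (D (iter i \<omega>))\<^sup>2)) \<le> \<mu> 0 * \<kappa> * (\<Sum>i<k. ?d i)"
    unfolding sum_distrib_left by (intro sum_mono) auto
  also have "\<dots> \<le> \<mu> 0 * \<kappa> * ((norm (x0 - xstar))\<^sup>2 + L2 * mu2 \<mu> k + 2 * L1 * ?w)"
    using mu_pos[of 0] kappa_pos by (intro mult_left_mono expected_feasibility_sum) auto
  also have "\<dots> = R_mu \<mu> \<kappa> L2 x0 xstar k + 2 * (\<kappa> * \<mu> 0 * L1) * ?w"
    by (simp add: R_mu_def algebra_simps)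
  finally have "(\<Sum>i<k. \<mu> i * (LINT \<omega>|N. (D (iter i \<omega>))\<^sup>2)) / mu1 \<mu> k
      \<le> (R_mu \<mu> \<kappa> L2 x0 xstar k + 2 * (\<kappa> * \<mu> 0 * L1) * ?w) / mu1 \<mu> k"
    using mu1_pos by (intro divide_right_mono) auto
  then have "Q \<le> R_mu \<mu> \<kappa> L2 x0 xstar k / mu1 \<mu> k + 2 * (\<kappa> * \<mu> 0 * L1) * (?w / mu1 \<mu> k)"
    unfolding Q by (simp add: add_divide_distrib)
  also have "2 * (\<kappa> * \<mu> 0 * L1) * (?w / mu1 \<mu> k) \<le> 2 * (\<kappa> * \<mu> 0 * L1) * sqrt Q"
    using w kappa_pos mu_pos[of 0] L1_nonneg by (intro mult_left_mono) auto
  \<comment> \<open>The first moment is traded for the second, the only one occurring in the final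
    bounds.\<close>
  also have "2 * (\<kappa> * \<mu> 0 * L1) * sqrt Q \<le> 2 * (\<kappa> * \<mu> 0 * sqrt L2) * sqrt Q"
    using L1_le kappa_pos mu_pos[of 0] Q_nonneg by (intro mult_right_mono mult_left_mono) auto
  finally show ?thesis by simp
qed

lemma R_nonneg: "0 \<le> R_mu \<mu> \<kappa> L2 x0 xstar k / mu1 \<mu> k"
  using mu_pos[of 0] kappa_pos L2_nonneg mu2_nonneg mu1_pos by (simp add: R_mu_def)

lemma sqrt_Q_le:
  "sqrt Q \<le> \<kappa> * sqrt L2 * (mu2 \<mu> k / mu1 \<mu> k + 2 * \<mu> 0) + sqrt (R_mu \<mu> \<kappa> L2 x0 xstar k / mu1 \<mu> k)"
proof -
  have "sqrt Q \<le> 2 * (\<kappa> * \<mu> 0 * sqrt L2) + sqrt (R_mu \<mu> \<kappa> L2 x0 xstar k / mu1 \<mu> k)"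
    using Q_quadratic Q_nonneg kappa_pos mu_pos[of 0] L2_nonneg R_nonneg
    by (intro le_of_square_le_affine) auto
  \<comment> \<open>The quadratic inequality produces the \<open>2 * \<mu> 0\<close> part; adding
    this nonnegative term gives the stated form.\<close>
  moreover have "0 \<le> \<kappa> * sqrt L2 * (mu2 \<mu> k / mu1 \<mu> k)"
    using kappa_pos L2_nonneg mu2_nonneg mu1_pos by simp
  ultimately show ?thesis by (simp add: algebra_simps)
qed

text \<open>The pointwise bound \<open>F_lower\<close> is averaged and the mean of
  \<open>D (xhat \<omega>)\<close> is at most \<open>sqrt Q\<close>. One factor
  \<open>sqrt L2\<close> comes from the Lipschitz constant of \<open>F\<close>, the other from the
  bound on \<open>sqrt Q\<close>, whence \<open>L2\<close>.\<close>

lemma objective_gap_lower: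
  "- \<kappa> * L2 * (mu2 \<mu> k / mu1 \<mu> k + 2 * \<mu> 0) - sqrt (L2 * (R_mu \<mu> \<kappa> L2 x0 xstar k / mu1 \<mu> k))
    \<le> (LINT \<omega>|N. F (xhat \<omega>)) - F xstar"
proof -
  have D_int: "integrable N (\<lambda>\<omega>. D (xhat \<omega>))"
    by (rule N.square_integrable_imp_integrable[OF _ D_xhat_integrable]) measurable
  have "(LINT \<omega>|N. F xstar - L1 * D (xhat \<omega>)) \<le> (LINT \<omega>|N. F (xhat \<omega>))"
    using D_int by (intro integral_mono F_xhat_integrable F_lower) auto
  then have 1: "- (L1 * (LINT \<omega>|N. D (xhat \<omega>))) \<le> (LINT \<omega>|N. F (xhat \<omega>)) - F xstar"
    using D_int by (simp add: N.prob_space)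
  have "(LINT \<omega>|N. D (xhat \<omega>))\<^sup>2 \<le> (LINT \<omega>|N. (D (xhat \<omega>))\<^sup>2)"
    by (rule N.square_expectation_le[OF _ D_xhat_integrable]) measurable
  then have "(LINT \<omega>|N. D (xhat \<omega>)) \<le> sqrt Q"
    using expected_D_xhat by (intro real_le_rsqrt) simp
  then have "L1 * (LINT \<omega>|N. D (xhat \<omega>)) \<le> L1 * sqrt Q"
    by (intro mult_left_mono L1_nonneg)
  also have "\<dots> \<le> sqrt L2 * sqrt Q"
    using Q_nonneg by (intro mult_right_mono L1_le) simp
  also have "\<dots> \<le> sqrt L2 * (\<kappa> * sqrt L2 * (mu2 \<mu> k / mu1 \<mu> k + 2 * \<mu> 0)
      + sqrt (R_mu \<mu> \<kappa> L2 x0 xstar k / mu1 \<mu> k))"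
    using L2_nonneg by (intro mult_left_mono sqrt_Q_le) simp
  also have "\<dots> = (sqrt L2 * sqrt L2) * (\<kappa> * (mu2 \<mu> k / mu1 \<mu> k + 2 * \<mu> 0))
      + sqrt L2 * sqrt (R_mu \<mu> \<kappa> L2 x0 xstar k / mu1 \<mu> k)"
    by (simp only: distrib_left mult_ac)
  also have "\<dots> = \<kappa> * L2 * (mu2 \<mu> k / mu1 \<mu> k + 2 * \<mu> 0)
      + sqrt (L2 * (R_mu \<mu> \<kappa> L2 x0 xstar k / mu1 \<mu> k))"
    using L2_nonneg by (simp only: real_sqrt_mult real_sqrt_mult_self abs_of_nonneg mult_ac)
  finally show ?thesis using 1 by linarith
qed

lemma feasibility_gap:
  "(LINT \<omega>|N. (D (xhat \<omega>))\<^sup>2) \<le> 2 * \<kappa>\<^sup>2 * L2 * (mu2 \<mu> k / mu1 \<mu> k + 2 * \<mu> 0)\<^sup>2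
    + 2 * R_mu \<mu> \<kappa> L2 x0 xstar k / mu1 \<mu> k"
proof -
  let ?A = "\<kappa> * sqrt L2 * (mu2 \<mu> k / mu1 \<mu> k + 2 * \<mu> 0)"
  let ?B = "sqrt (R_mu \<mu> \<kappa> L2 x0 xstar k / mu1 \<mu> k)"
  have "Q = (sqrt Q)\<^sup>2"
    using Q_nonneg by simp
  also have "\<dots> \<le> (?A + ?B)\<^sup>2"
    using Q_nonneg by (intro power_mono sqrt_Q_le) simp
  \<comment> \<open>The factors 2 of the final estimate come from
    \<open>(A + B)\<^sup>2 \<le> 2 * A\<^sup>2 + 2 * B\<^sup>2\<close>.\<close>
  also have "\<dots> \<le> 2 * ?A\<^sup>2 + 2 * ?B\<^sup>2"
    using sum_squares_bound[of ?A ?B] by (simp add: power2_sum)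
  also have "\<dots> = 2 * \<kappa>\<^sup>2 * L2 * (mu2 \<mu> k / mu1 \<mu> k + 2 * \<mu> 0)\<^sup>2
    + 2 * R_mu \<mu> \<kappa> L2 x0 xstar k / mu1 \<mu> k"
    using L2_nonneg R_nonneg by (simp add: power_mult_distrib)
  finally show ?thesis using expected_D_xhat by linarith
qed

end

end

theorem theorem7:
  fixes M :: "'s measure"
    and f :: "'s \<Rightarrow> real ^ 'n \<Rightarrow> real"
    and X :: "'s \<Rightarrow> (real ^ 'n) set"
    and L :: "'s \<Rightarrow> real"
    and \<kappa> :: real
    and \<mu> :: "nat \<Rightarrow> real"
    and x0 xstar :: "real ^ 'n"
    and N :: "'w measure"
    and S :: "nat \<Rightarrow> 'w \<Rightarrow> 's"
    and xhat :: "nat \<Rightarrow> 'w \<Rightarrow> real ^ 'n"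
    and k :: nat
  assumes "prob_space M"
    and f_integrable: "\<And>x. integrable M (\<lambda>s. f s x)"
    and f_convex: "\<And>s. s \<in> space M \<Longrightarrow> convex_on UNIV (f s)"
    and L_pos: "\<And>s. s \<in> space M \<Longrightarrow> L s > 0"
    and f_lipschitz: "\<And>s x y. s \<in> space M \<Longrightarrow> \<bar>f s x - f s y\<bar> \<le> L s * norm (x - y)"
    and L_integrable: "integrable M (\<lambda>s. (L s)\<^sup>2)"
    and X_set: "\<And>s. s \<in> space M \<Longrightarrow> X s \<noteq> {} \<and> closed (X s) \<and> convex (X s)"
    and X_measurable: "\<And>x. (\<lambda>s. dist_proj (X s) x) \<in> borel_measurable M"
    and xstar_optimal: "is_arg_min (objective M f) (\<lambda>x. x \<in> feasible M X) xstar"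
    and kappa_pos: "\<kappa> > 0"
    and regularity: "\<And>x. (dist_proj (feasible M X) x)\<^sup>2 \<le> \<kappa> * (LINT s|M. (dist_proj (X s) x)\<^sup>2)"
    and mu_pos: "\<And>i. \<mu> i > 0"
    and mu_decseq: "decseq \<mu>"
    and "prob_space N"
    and S_indep: "prob_space.indep_vars N (\<lambda>_. M) S UNIV"
    and S_distr: "\<And>i. distr N M (S i) = M"
    and xhat_eq: "\<And>j \<omega>. xhat j \<omega> = wavg \<mu> (spp f X \<mu> x0 (\<lambda>i. S i \<omega>)) j"
    and k_pos: "k \<ge> 1"
  shows "integrable N (\<lambda>\<omega>. objective M f (xhat k \<omega>))
    \<and> integrable N (\<lambda>\<omega>. (dist_proj (feasible M X) (xhat k \<omega>))\<^sup>2)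
    \<and> - \<kappa> * (LINT s|M. (L s)\<^sup>2) * (mu2 \<mu> k / mu1 \<mu> k + 2 * \<mu> 0)
        - sqrt ((LINT s|M. (L s)\<^sup>2) * (R_mu \<mu> \<kappa> (LINT s|M. (L s)\<^sup>2) x0 xstar k / mu1 \<mu> k))
      \<le> (LINT \<omega>|N. objective M f (xhat k \<omega>)) - opt_value M f X
    \<and> (LINT \<omega>|N. objective M f (xhat k \<omega>)) - opt_value M f X
      \<le> R_mu \<mu> \<kappa> (LINT s|M. (L s)\<^sup>2) x0 xstar k / (2 * \<mu> 0 * \<kappa> * mu1 \<mu> k)
    \<and> (LINT \<omega>|N. (dist_proj (feasible M X) (xhat k \<omega>))\<^sup>2)
      \<le> 2 * \<kappa>\<^sup>2 * (LINT s|M. (L s)\<^sup>2) * (mu2 \<mu> k / mu1 \<mu> k + 2 * \<mu> 0)\<^sup>2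
        + 2 * R_mu \<mu> \<kappa> (LINT s|M. (L s)\<^sup>2) x0 xstar k / mu1 \<mu> k"
proof -
  interpret spp_process M N f X L \<kappa> \<mu> x0 xstar S
    by (intro spp_process.intro spp_process_axioms.intro) fact+
  have xhat: "xhat k = spp_process.xhat f X \<mu> x0 S k"
    by (simp add: fun_eq_iff xhat_eq xhat_def[OF k_pos] iter_def[abs_def])
  show ?thesis
    unfolding xhat opt_value_eq L2_def[symmetric]
    using F_xhat_integrable[OF k_pos] D_xhat_integrable[OF k_pos] objective_gap_lower[OF k_pos]
      objective_gap_upper[OF k_pos] feasibility_gap[OF k_pos]
    by blast
qed

end
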